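(* Let $\omega\in\mathbb R^n\setminus\{0\}$. Then there exist a sequence $(\varepsilon_j)_{j\in\mathbb N}$ of positive real numbers, a sequence $(f_j)_{j\in\mathbb N}$ of functions in $G^{\alpha,L}(\mathcal D_R)$, and positive constants $a_1,\dots,a_8$ and $j_0$ depending only on $n,R,\omega,\alpha$ and $L$, with $$a_1\varepsilon_j\le|f_j|_{\alpha,L}\le a_2\varepsilon_j,\qquad \lim_{j\to+\infty}\varepsilon_j=0,$$ such that for $j\ge j_0$, the Hamiltonian system defined by $H_j=l_\omega+f_j$, with $l_\omega(I)=\omega\cdot I$, has solutions $(\theta(t),I(t))$, with $I_0=I(0)$, which satisfy $$a_3|t|\varepsilon_j\exp\left(-a_4\,\Delta_\omega^*(a_5\varepsilon_j^{-1})^{\frac1\alpha}\right)\le|\Pi_F(I(t)-I_0)|\le a_6|t|\varepsilon_j\exp\left(-a_7\,\Delta_\omega^*(a_8\varepsilon_j^{-1})^{\frac1\alpha}\right)$$ for all times $t$ for which they are defined in $\mathcal D_R$.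
   Context: Here $n\ge2$ is an integer, $R>0$, $\alpha\ge1$, $L>0$, and $\mathbb T^n=\mathbb R^n/\mathbb Z^n$. $|\cdot|$ is the supremum norm of vectors and $\cdot$ the Euclidean scalar product. $B_R\subset\mathbb R^n$ is the closed ball of radius $R$ centered at the origin for the supremum norm, and $\mathcal D_R=\mathbb T^n\times B_R$, with coordinates $(\theta,I)$ and the canonical symplectic structure; the Hamiltonian system defined by $H$ is $\dot\theta=\partial_IH$, $\dot I=-\partial_\theta H$. Gevrey functions: a real-valued $f\in C^\infty(\mathcal D_R)$ belongs to $G^{\alpha,L}(\mathcal D_R)$ if $|f|_{\alpha,L}=\sup_{l\in\mathbb N^{2n}}L^{|l|\alpha}(l!)^{-\alpha}|\partial^l f|_{C^0(\mathcal D_R)}<\infty$ (multi-index notation, $|l|$ the sum of the components of $l$). Arithmetic of $\omega$: $F=F_\omega$ is the smallest rational subspace of $\mathbb R^n$ containing $\omega$ (a subspace is rational if it has a basis of vectors with rational components), $d=\dim F$, $1\le d\le n$, and $\Pi_F$ is the (orthogonal) projection onto $F$. $Q_\omega>0$ is a constant depending only on $\omega$ such that $\{k\in\mathbb Z^n\cap F: 0<|k|\le Q\}\neq\emptyset$ for $Q\ge Q_\omega$. For $Q\ge Q_\omega$, $$\Psi_\omega(Q)=\max\{|k\cdot\omega|^{-1}: k\in\mathbb Z^n\cap F,\ 0<|k|\le Q\},\qquad \Delta_\omega(Q)=Q\Psi_\omega(Q),$$ and $\Delta_\omega^*(x)=\sup\{Q\ge Q_\omega:\Delta_\omega(Q)\le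 x\}$ for $x\ge\Delta_\omega(Q_\omega)$. Whenever $\Delta_\omega^*(x)$ is written it is understood that $x\ge\Delta_\omega(Q_\omega)$. *)

theory Defs
  imports "HOL-Analysis.Analysis"
begin

text \<open>
  The phase space is handled on the universal cover of the torus: a point is a pair
  \<open>(\<theta>, I)\<close> of vectors of \<open>real ^ 'n\<close>, functions on the phase space are functions of
  \<open>(\<theta>, I)\<close> that are integer-periodic in \<open>\<theta>\<close>, and solution curves are lifted to the
  cover.  The supremum norm is the library constant \<open>infnorm\<close>, and \<open>\<bullet>\<close> is the Euclidean
  scalar product.
\<close>

type_synonym 'n phase = "(real ^ 'n) \<times> (real ^ 'n)"

definition int_vectors :: "(real ^ 'n) set" where
  "int_vectors = {k. \<forall>i. k $ i \<in> \<int>}"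

definition phase_domain :: "real \<Rightarrow> 'n::finite phase set" where
  "phase_domain R = UNIV \<times> {I. infnorm I \<le> R}"

definition torus_periodic_on :: "'n::finite phase set \<Rightarrow> ('n phase \<Rightarrow> real) \<Rightarrow> bool" where
  "torus_periodic_on D f \<longleftrightarrow>
     (\<forall>\<theta> I. \<forall>k\<in>int_vectors. (\<theta>, I) \<in> D \<longrightarrow> f (\<theta> + k, I) = f (\<theta>, I))"


subsection \<open>Partial derivatives and Gevrey functions\<close>

text \<open>The \<open>2n\<close> coordinates are indexed by \<open>'n + 'n\<close>: \<open>Inl i\<close> stands for \<open>\<theta>\<^sub>i\<close> and
  \<open>Inr i\<close> for \<open>I\<^sub>i\<close>.\<close>

definition coord_dir :: "'n::finite + 'n \<Rightarrow> 'n phase" where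
  "coord_dir = case_sum (\<lambda>i. (axis i 1, 0)) (\<lambda>i. (0, axis i 1))"

text \<open>Derivatives are taken within \<open>D\<close>.  For \<open>D = phase_domain R\<close> with \<open>R > 0\<close> they are the
  usual partial derivatives at interior points and the one-sided ones where \<open>I\<close> is on a face of
  the closed cube; in particular only the values of the function on \<open>D\<close> matter.\<close>

definition partially_differentiable_on ::
    "'n::finite phase set \<Rightarrow> 'n + 'n \<Rightarrow> ('n phase \<Rightarrow> real) \<Rightarrow> bool" where
  "partially_differentiable_on D i f \<longleftrightarrow>
     (\<forall>z\<in>D. (\<lambda>h. f (z + h *\<^sub>R coord_dir i))
        differentiable (at 0 within {h. z + h *\<^sub>R coord_dir i \<in> D}))"

definition partial_on ::
    "'n::finite phase set \<Rightarrow> 'n + 'n \<Rightarrow> ('n phase \<Rightarrow> real) \<Rightarrow> 'n phase \<Rightarrow> real" where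
  "partial_on D i f z =
     vector_derivative (\<lambda>h. f (z + h *\<^sub>R coord_dir i))
       (at 0 within {h. z + h *\<^sub>R coord_dir i \<in> D})"

definition smooth_fun_on :: "'n::finite phase set \<Rightarrow> ('n phase \<Rightarrow> real) \<Rightarrow> bool" where
  "smooth_fun_on D f \<longleftrightarrow>
     (\<forall>is. continuous_on D (foldr (partial_on D) is f) \<and>
           (\<forall>i. partially_differentiable_on D i (foldr (partial_on D) is f)))"

text \<open>The iterated derivative for a multi-index \<open>l\<close>: differentiate \<open>l i\<close> times with respect to
  coordinate \<open>i\<close>.  The order of differentiation, which is irrelevant for smooth functions, is
  left to the choice operator.\<close>

definition multi_partial_on ::
    "'n::finite phase set \<Rightarrow> ('n + 'n \<Rightarrow> nat) \<Rightarrow> ('n phase \<Rightarrow> real) \<Rightarrow> 'n phase \<Rightarrow> real" where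
  "multi_partial_on D l f = foldr (partial_on D) (SOME is. \<forall>i. count_list is i = l i) f"

definition C0_norm_on :: "'n::finite phase set \<Rightarrow> ('n phase \<Rightarrow> real) \<Rightarrow> real" where
  "C0_norm_on D g = (SUP z\<in>D. \<bar>g z\<bar>)"

definition gevrey_term ::
    "real \<Rightarrow> real \<Rightarrow> 'n::finite phase set \<Rightarrow> ('n phase \<Rightarrow> real) \<Rightarrow> ('n + 'n \<Rightarrow> nat) \<Rightarrow> real" where
  "gevrey_term \<alpha> L D f l =
     L powr (real (\<Sum>i\<in>UNIV. l i) * \<alpha>) * (\<Prod>i\<in>UNIV. fact (l i)) powr (- \<alpha>)
       * C0_norm_on D (multi_partial_on D l f)"

definition gevrey_norm ::
    "real \<Rightarrow> real \<Rightarrow> 'n::finite phase set \<Rightarrow> ('n phase \<Rightarrow> real) \<Rightarrow> real" where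
  "gevrey_norm \<alpha> L D f = (SUP l. gevrey_term \<alpha> L D f l)"

text \<open>The real-valued suprema above are meaningful on this class: \<open>C0_norm_on\<close> because a
  periodic continuous function on \<open>phase_domain R\<close> is bounded, and \<open>gevrey_norm\<close> by the last
  conjunct, which expresses its finiteness.\<close>

definition gevrey_class ::
    "real \<Rightarrow> real \<Rightarrow> 'n::finite phase set \<Rightarrow> ('n phase \<Rightarrow> real) set" where
  "gevrey_class \<alpha> L D =
     {f. torus_periodic_on D f \<and> smooth_fun_on D f \<and> bdd_above (range (gevrey_term \<alpha> L D f))}"


subsection \<open>Hamiltonian systems\<close>

definition hamiltonian_solution ::
    "'n::finite phase set \<Rightarrow> ('n phase \<Rightarrow> real) \<Rightarrow> real set
      \<Rightarrow> (real \<Rightarrow> real ^ 'n) \<Rightarrow> (real \<Rightarrow> real ^ 'n) \<Rightarrow> bool" where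
  "hamiltonian_solution D H J \<theta> I \<longleftrightarrow>
     is_interval J \<and>
     (\<forall>t\<in>J. (\<theta> t, I t) \<in> D \<and>
        (\<theta> has_vector_derivative (\<chi> i. partial_on D (Inr i) H (\<theta> t, I t))) (at t within J) \<and>
        (I has_vector_derivative (\<chi> i. - partial_on D (Inl i) H (\<theta> t, I t))) (at t within J))"

text \<open>\<open>J\<close> is the set of all times for which the solution is defined in \<open>D\<close>.\<close>

definition maximal_hamiltonian_solution ::
    "'n::finite phase set \<Rightarrow> ('n phase \<Rightarrow> real) \<Rightarrow> real set
      \<Rightarrow> (real \<Rightarrow> real ^ 'n) \<Rightarrow> (real \<Rightarrow> real ^ 'n) \<Rightarrow> bool" where
  "maximal_hamiltonian_solution D H J \<theta> I \<longleftrightarrow>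
     hamiltonian_solution D H J \<theta> I \<and>
     (\<forall>J' \<theta>' I'. hamiltonian_solution D H J' \<theta>' I' \<and> J \<subseteq> J' \<and>
        (\<forall>t\<in>J. \<theta>' t = \<theta> t \<and> I' t = I t) \<longrightarrow> J' = J)"


subsection \<open>Arithmetic of the frequency vector\<close>

definition rational_subspace :: "(real ^ 'n::finite) set \<Rightarrow> bool" where
  "rational_subspace S \<longleftrightarrow>
     (\<exists>B. independent B \<and> span B = S \<and> (\<forall>b\<in>B. \<forall>i. b $ i \<in> \<rat>))"

text \<open>Least element with respect to inclusion.\<close>

definition rat_hull :: "real ^ 'n::finite \<Rightarrow> (real ^ 'n) set" where
  "rat_hull \<omega> = (LEAST S. rational_subspace S \<and> \<omega> \<in> S)"

definition orth_proj :: "(real ^ 'n::finite) set \<Rightarrow> real ^ 'n \<Rightarrow> real ^ 'n" where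
  "orth_proj S x = (THE y. y \<in> S \<and> (\<forall>z\<in>S. orthogonal (x - y) z))"

definition freq_lattice :: "real ^ 'n::finite \<Rightarrow> real \<Rightarrow> (real ^ 'n) set" where
  "freq_lattice \<omega> Q = {k \<in> int_vectors \<inter> rat_hull \<omega>. 0 < infnorm k \<and> infnorm k \<le> Q}"

definition admissible_Q :: "real ^ 'n::finite \<Rightarrow> real \<Rightarrow> bool" where
  "admissible_Q \<omega> Q0 \<longleftrightarrow> Q0 > 0 \<and> (\<forall>Q\<ge>Q0. freq_lattice \<omega> Q \<noteq> {})"

definition Psi :: "real ^ 'n::finite \<Rightarrow> real \<Rightarrow> real" where
  "Psi \<omega> Q = Max ((\<lambda>k. inverse \<bar>k \<bullet> \<omega>\<bar>) ` freq_lattice \<omega> Q)"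

definition Delta :: "real ^ 'n::finite \<Rightarrow> real \<Rightarrow> real" where
  "Delta \<omega> Q = Q * Psi \<omega> Q"

definition Delta_star :: "real ^ 'n::finite \<Rightarrow> real \<Rightarrow> real \<Rightarrow> real" where
  "Delta_star \<omega> Q0 x = Sup {Q. Q \<ge> Q0 \<and> Delta \<omega> Q \<le> x}"

end

theory Submission
  imports Defs
begin

text \<open>
  Put \<open>F = rat_hull \<omega>\<close>.  The drift is produced by an exact resonance created by a tiny linear term.
  Let \<open>k\<close> be an integer vector and \<open>\<epsilon> = \<bar>k \<bullet> \<omega>\<bar> / infnorm k\<close>.  A linear Hamiltonian \<open>s * I $ i\<close> with
  \<open>\<bar>s\<bar> = \<epsilon>\<close>, where \<open>i\<close> is a coordinate at which \<open>k\<close> is largest, changes the frequency into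
  \<open>\<omega> + axis i s\<close>, which is orthogonal to \<open>k\<close>.  Adding \<open>A * cos (2 * pi * (k \<bullet> \<theta>))\<close> then gives a system in
  which the phase \<open>k \<bullet> \<theta>\<close> is constant along solutions; for the phase \<open>1 / 4\<close> the action moves along
  the straight line \<open>I t = (2 * pi * A * t) *\<^sub>R k\<close> until it leaves the cube
  (\<open>resonant_wave_solution\<close>).  Each derivative of the cosine costs a factor \<open>2 * pi * infnorm k\<close>, so its
  Gevrey norm is at most \<open>A * exp (c * infnorm k powr (1 / \<alpha>))\<close> for a constant \<open>c\<close>, and the choice
  \<open>A = \<epsilon> * exp (- c * infnorm k powr (1 / \<alpha>))\<close> keeps the perturbation of size \<open>\<epsilon>\<close> (\<open>gevrey_wave\<close>).

  It remains to choose \<open>k\<close> so that \<open>infnorm k\<close> equals \<open>Delta_star\<close> at \<open>1 / \<epsilon>\<close>.  As \<open>Delta\<close> is strictly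
  increasing, \<open>Delta_star\<close> inverts it on the left (\<open>Delta_star_Delta\<close>), so it suffices that
  \<open>1 / \<epsilon> = Delta \<omega> (infnorm k)\<close>, that is, that \<open>\<bar>k \<bullet> \<omega>\<bar>\<close> be the smallest divisor up to the length of
  \<open>k\<close>.  Moreover \<open>k\<close> must be arbitrarily long, for \<open>\<epsilon>\<close> to tend to zero, and its projection onto \<open>F\<close> must
  be nonzero (\<open>drift_frequency\<close>).  If \<open>F\<close> has dimension at least two, the divisors of the lattice
  of \<open>F\<close> accumulate at zero, and the successive record minimisers do; they lie in \<open>F\<close>.  If \<open>F\<close> is
  a line, the lattice has a shortest vector \<open>l\<close> that minimises the divisor, and \<open>l + m *\<^sub>R k'\<close> has the
  same divisor for each integer vector \<open>k'\<close> orthogonal to \<open>F\<close>; its projection onto \<open>F\<close> is \<open>l\<close>.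

  Both cases use that \<open>F\<close> exists and contains no nonzero integer vector orthogonal to \<open>\<omega>\<close>.  This
  follows from the identification of \<open>F\<close> with the set of all vectors that satisfy every integer
  relation satisfied by \<open>\<omega>\<close> (\<open>rat_hull_eq\<close>).
\<close>

section \<open>The rational hull of the frequency vector\<close>

definition rational_vector :: "real ^ 'n::finite \<Rightarrow> bool" where
  "rational_vector x \<longleftrightarrow> (\<forall>i. x $ i \<in> \<rat>)"

lemma rational_vector_int_multiple:
  fixes x :: "real ^ 'n::finite"
  assumes "rational_vector x"
  obtains q :: real where "q > 0" "q *\<^sub>R x \<in> int_vectors"
proof -
  have "\<exists>m::int. m > 0 \<and> real_of_int m * x $ i \<in> \<int>" for i
  proof -
    have "x $ i \<in> \<rat>" using assms by (simp add: rational_vector_def)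
    then obtain a b :: int where "b > 0" "x $ i = of_int a / of_int b"
      by (auto elim: Rats_cases')
    then have "real_of_int b * x $ i = of_int a" by simp
    then show ?thesis using \<open>b > 0\<close> by (metis Ints_of_int)
  qed
  then obtain m :: "'n \<Rightarrow> int" where m: "\<And>i. m i > 0" "\<And>i. real_of_int (m i) * x $ i \<in> \<int>"
    by metis
  define q where "q = (\<Prod>i\<in>UNIV. real_of_int (m i))"
  have "q * x $ i \<in> \<int>" for i
  proof -
    have "q * x $ i = (\<Prod>j\<in>UNIV - {i}. real_of_int (m j)) * (real_of_int (m i) * x $ i)"
      unfolding q_def by (subst prod.remove[of UNIV i]) (auto simp: mult_ac)
    also have "\<dots> \<in> \<int>"
      by (intro Ints_mult Ints_prod m Ints_of_int)
    finally show ?thesis .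
  qed
  moreover have "q > 0" unfolding q_def by (intro prod_pos) (simp add: m)
  ultimately show thesis by (intro that[of q]) (auto simp: int_vectors_def)
qed

lemma rational_vector_inner: "rational_vector x \<Longrightarrow> rational_vector y \<Longrightarrow> x \<bullet> y \<in> \<rat>"
  unfolding inner_vec_def rational_vector_def by (auto intro!: Rats_sum)

text \<open>Gaussian elimination over the rationals.  Passing from \<open>B\<close> to \<open>insert b B\<close> cuts the solution
  space \<open>span C\<close> with one more hyperplane, and the projection of \<open>C\<close> onto this hyperplane along an
  element of \<open>C\<close> outside it has rational coefficients, so it keeps the vectors rational.\<close>

lemma rational_annihilator:
  fixes B :: "(real ^ 'n::finite) set"
  assumes "finite B" "\<forall>b\<in>B. rational_vector b"
  shows "\<exists>C. finite C \<and> (\<forall>c\<in>C. rational_vector c) \<and> span C = {x. \<forall>b\<in>B. b \<bullet> x = 0}"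
  using assms
proof (induction B)
  case empty
  have "rational_vector c" if "c \<in> (Basis :: (real^'n) set)" for c
    using that by (auto simp: Basis_vec_def rational_vector_def axis_def)
  then show ?case by (intro exI[of _ Basis]) auto
next
  case (insert b B)
  then obtain C where C: "finite C" "\<forall>c\<in>C. rational_vector c"
    and spanC: "span C = {x. \<forall>b\<in>B. b \<bullet> x = 0}" by auto
  show ?case
  proof (cases "\<forall>c\<in>C. b \<bullet> c = 0")
    case True
    have "b \<bullet> x = 0" if "x \<in> span C" for x
      using that by (induction rule: span_induct) (auto simp: subspace_hyperplane True)
    then show ?thesis using C spanC by (intro exI[of _ C]) auto
  next
    case False
    then obtain c0 where c0: "c0 \<in> C" "b \<bullet> c0 \<noteq> 0" by auto
    \<comment> \<open>the projection onto the hyperplane orthogonal to \<open>b\<close> along \<open>c0\<close>\<close>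
    define T where "T x = x - ((b \<bullet> x) / (b \<bullet> c0)) *\<^sub>R c0" for x
    have linT: "linear T"
      by (rule linearI) (auto simp: T_def inner_add_right add_divide_distrib algebra_simps)
    have bT: "b \<bullet> T x = 0" for x using c0 by (simp add: T_def inner_diff_right)
    have Tspan: "T x \<in> span C" if "x \<in> span C" for x
      unfolding T_def using that c0 by (intro span_diff span_scale) (auto intro: span_base)
    have Tid: "T x = x" if "b \<bullet> x = 0" for x using that by (simp add: T_def)
    have "span (T ` C) = T ` span C" by (rule linear_span_image[OF linT])
    also have "\<dots> = {x. \<forall>b\<in>insert b B. b \<bullet> x = 0}"
    proof (intro equalityI subsetI)
      fix x assume "x \<in> T ` span C"
      then show "x \<in> {x. \<forall>b\<in>insert b B. b \<bullet> x = 0}"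
        using bT Tspan spanC by auto
    next
      fix x assume x: "x \<in> {x. \<forall>b\<in>insert b B. b \<bullet> x = 0}"
      then have "x \<in> span C" "T x = x" using spanC Tid by auto
      then show "x \<in> T ` span C" by force
    qed
    finally have "span (T ` C) = {x. \<forall>b\<in>insert b B. b \<bullet> x = 0}" .
    moreover have "rational_vector (T c)" if "c \<in> C" for c
    proof -
      have "b \<bullet> c \<in> \<rat>" "b \<bullet> c0 \<in> \<rat>"
        using C(2) c0 that insert.prems by (auto intro: rational_vector_inner)
      then show ?thesis
        using C(2) c0(1) that by (auto simp: rational_vector_def T_def)
    qed
    ultimately show ?thesis using C(1) by (intro exI[of _ "T ` C"]) auto
  qed
qed

lemma rational_subspace_span:
  assumes "\<forall>c\<in>C. rational_vector c"
  shows "rational_subspace (span C)"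
proof -
  obtain B where "B \<subseteq> C" "independent B" "C \<subseteq> span B"
    using maximal_independent_subset by blast
  then have "span B = span C" by (metis span_mono span_span subset_antisym)
  then show ?thesis using \<open>B \<subseteq> C\<close> \<open>independent B\<close> assms
    unfolding rational_subspace_def rational_vector_def by blast
qed

lemma int_vectors_rational: "k \<in> int_vectors \<Longrightarrow> rational_vector k"
  using Ints_subset_Rats by (auto simp: int_vectors_def rational_vector_def)

lemma rational_subspace_annihilator:
  fixes M :: "(real ^ 'n::finite) set"
  assumes "\<forall>k\<in>M. rational_vector k"
  shows "rational_subspace {x. \<forall>k\<in>M. k \<bullet> x = 0}"
proof -
  obtain B where B: "B \<subseteq> M" "independent B" "M \<subseteq> span B"
    using maximal_independent_subset by blast
  have "k \<bullet> x = 0" if "\<forall>b\<in>B. b \<bullet> x = 0" "k \<in> M" for x k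
  proof -
    have "k \<in> span B" using that B by auto
    then show ?thesis
      by (induction rule: span_induct)
         (use that in \<open>auto simp: inner_commute[of _ x] subspace_hyperplane\<close>)
  qed
  then have "{x. \<forall>k\<in>M. k \<bullet> x = 0} = {x. \<forall>b\<in>B. b \<bullet> x = 0}" using B(1) by blast
  moreover obtain C where "\<forall>c\<in>C. rational_vector c" "span C = {x. \<forall>b\<in>B. b \<bullet> x = 0}"
    using rational_annihilator[of B] B assms by (meson finiteI_independent subsetD)
  ultimately show ?thesis using rational_subspace_span[of C] by metis
qed

text \<open>A description of the rational hull by integer relations.  Unlike the description as a least
  subspace, it shows directly which integer vectors can be resonant with \<open>\<omega>\<close>.\<close>

definition resonant_annihilator :: "real ^ 'n::finite \<Rightarrow> (real ^ 'n) set" where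
  "resonant_annihilator \<omega> = {x. \<forall>k\<in>int_vectors. k \<bullet> \<omega> = 0 \<longrightarrow> k \<bullet> x = 0}"

text \<open>A rational subspace \<open>S\<close> containing \<open>\<omega>\<close> has an orthogonal complement spanned by rational vectors.
  Integer multiples of these are relations satisfied by \<open>\<omega>\<close>, hence by every element of the
  annihilator, which therefore lies in the double complement of \<open>S\<close>, that is, in \<open>S\<close>.\<close>

lemma resonant_annihilator_least:
  fixes \<omega> :: "real ^ 'n::finite"
  assumes "rational_subspace S" "\<omega> \<in> S"
  shows "resonant_annihilator \<omega> \<subseteq> S"
proof
  fix x assume x: "x \<in> resonant_annihilator \<omega>"
  obtain B where B: "independent B" "span B = S" "\<forall>b\<in>B. rational_vector b"
    using assms(1) unfolding rational_subspace_def rational_vector_def by blast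
  obtain C where C: "\<forall>c\<in>C. rational_vector c" "span C = {x. \<forall>b\<in>B. b \<bullet> x = 0}"
    using rational_annihilator[of B] B finiteI_independent by blast
  have SC: "c \<bullet> y = 0" if "y \<in> S" "c \<in> span C" for c y
  proof -
    have "c \<bullet> b = 0" if "b \<in> B" for b
      using that \<open>c \<in> span C\<close> C(2) by (auto simp: inner_commute[of c])
    moreover have "y \<in> span B" using that B by simp
    ultimately show ?thesis
      using span_induct[of y B "\<lambda>y. c \<bullet> y = 0"] by (simp add: subspace_hyperplane)
  qed
  have "c \<bullet> x = 0" if c: "c \<in> C" for c
  proof -
    obtain q :: real where q: "q > 0" "q *\<^sub>R c \<in> int_vectors"
      using rational_vector_int_multiple C(1) c by metis
    have "(q *\<^sub>R c) \<bullet> \<omega> = 0" using SC[OF assms(2)] c by (simp add: span_base)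
    then have "(q *\<^sub>R c) \<bullet> x = 0" using x q unfolding resonant_annihilator_def by blast
    then show ?thesis using q by simp
  qed
  then have "y \<bullet> x = 0" if "y \<in> span C" for y
    using span_induct[OF that, of "\<lambda>y. y \<bullet> x = 0"]
    by (simp add: inner_commute[of _ x] subspace_hyperplane)
  moreover have "S\<^sup>\<bottom> \<subseteq> span C"
    using B(2) C(2) by (auto simp: orthogonal_comp_def orthogonal_def intro: span_base)
  ultimately have "x \<in> S\<^sup>\<bottom>\<^sup>\<bottom>" unfolding orthogonal_comp_def[of "S\<^sup>\<bottom>"] orthogonal_def by auto
  then show "x \<in> S" using orthogonal_comp_self[of S] B(2) by (metis subspace_span)
qed

lemma rational_resonant_annihilator: "rational_subspace (resonant_annihilator \<omega>)"
proof -
  have "resonant_annihilator \<omega> = {x. \<forall>k\<in>{k \<in> int_vectors. k \<bullet> \<omega> = 0}. k \<bullet> x = 0}"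
    by (auto simp: resonant_annihilator_def)
  then show ?thesis
    using rational_subspace_annihilator[of "{k \<in> int_vectors. k \<bullet> \<omega> = 0}"]
    by (simp add: int_vectors_rational)
qed

lemma rat_hull_eq: "rat_hull \<omega> = resonant_annihilator \<omega>"
  unfolding rat_hull_def
proof (rule Least_equality)
  show "rational_subspace (resonant_annihilator \<omega>) \<and> \<omega> \<in> resonant_annihilator \<omega>"
    by (simp add: rational_resonant_annihilator) (simp add: resonant_annihilator_def)
qed (simp add: resonant_annihilator_least)

lemma rational_rat_hull: "rational_subspace (rat_hull \<omega>)"
  by (simp add: rat_hull_eq rational_resonant_annihilator)

lemma subspace_rat_hull: "subspace (rat_hull \<omega>)"
  using rational_rat_hull[of \<omega>] unfolding rational_subspace_def by (metis subspace_span)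

lemma mem_rat_hull: "\<omega> \<in> rat_hull \<omega>"
  by (simp add: rat_hull_eq resonant_annihilator_def)

text \<open>If such a \<open>k\<close> were resonant, it would be one of the relations that define the hull, so it would
  be orthogonal to itself.\<close>

lemma rat_hull_nonresonant:
  assumes "k \<in> int_vectors" "k \<in> rat_hull \<omega>" "k \<noteq> 0"
  shows "k \<bullet> \<omega> \<noteq> 0"
  using assms by (auto simp: rat_hull_eq resonant_annihilator_def)

lemma orth_proj_eqI:
  assumes S: "subspace S" and y: "y \<in> S" "\<And>z. z \<in> S \<Longrightarrow> orthogonal (x - y) z"
  shows "orth_proj S x = y"
  unfolding orth_proj_def
proof (rule the_equality)
  fix y' assume y': "y' \<in> S \<and> (\<forall>z\<in>S. orthogonal (x - y') z)"
  have "y' - y \<in> S" using S y y' by (simp add: subspace_diff)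
  then have "(x - y) \<bullet> (y' - y) = 0" "(x - y') \<bullet> (y' - y) = 0"
    using y y' by (auto simp: orthogonal_def)
  then have "(y' - y) \<bullet> (y' - y) = 0" by (simp add: inner_diff_left)
  then show "y' = y" by simp
qed (use y in auto)

section \<open>Integer vectors and the supremum norm\<close>

lemma infnorm_attained:
  fixes x :: "real ^ 'n::finite"
  obtains i where "\<bar>x $ i\<bar> = infnorm x"
proof -
  have "infnorm x \<in> (\<lambda>b. \<bar>x \<bullet> b\<bar>) ` Basis"
    unfolding infnorm_Max by (rule Max_in) auto
  then show thesis using that by (auto simp: Basis_vec_def inner_axis)
qed

lemma infnorm_le_iff:
  fixes x :: "real ^ 'n::finite"
  shows "infnorm x \<le> r \<longleftrightarrow> (\<forall>i. \<bar>x $ i\<bar> \<le> r)"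
  by (metis component_le_infnorm_cart infnorm_attained order_trans)

lemma int_vectors_infnorm_ge_1:
  fixes k :: "real ^ 'n::finite"
  assumes "k \<in> int_vectors" "k \<noteq> 0"
  shows "infnorm k \<ge> 1"
proof -
  obtain i where "k $ i \<noteq> 0" using assms(2) by (auto simp: vec_eq_iff)
  moreover have "k $ i \<in> \<int>" using assms(1) by (simp add: int_vectors_def)
  ultimately have "\<bar>k $ i\<bar> \<ge> 1" using Ints_nonzero_abs_ge1 by blast
  then show ?thesis using component_le_infnorm_cart[of k i] by linarith
qed

lemma int_vectors_add: "k \<in> int_vectors \<Longrightarrow> l \<in> int_vectors \<Longrightarrow> k + l \<in> int_vectors"
  by (auto simp: int_vectors_def)

lemma int_vectors_scaleR: "c \<in> \<int> \<Longrightarrow> k \<in> int_vectors \<Longrightarrow> c *\<^sub>R k \<in> int_vectors"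
  by (auto simp: int_vectors_def)

lemma finite_bounded_int_vectors:
  "finite {k :: real ^ 'n::finite. k \<in> int_vectors \<and> infnorm k \<le> Q}"
proof -
  let ?A = "{x::real. x \<in> \<int> \<and> \<bar>x\<bar> \<le> Q}"
  have "finite (PiE (UNIV :: 'n set) (\<lambda>_. ?A))"
    by (intro finite_PiE) (auto intro: finite_abs_int_segment)
  then have "finite (vec_lambda ` PiE (UNIV :: 'n set) (\<lambda>_. ?A))" by (rule finite_imageI)
  moreover have "k \<in> vec_lambda ` PiE UNIV (\<lambda>_. ?A)"
    if "k \<in> int_vectors" "infnorm k \<le> Q" for k :: "real ^ 'n"
    using that by (intro image_eqI[of _ _ "vec_nth k"])
        (auto simp: int_vectors_def infnorm_le_iff)
  ultimately show ?thesis by (elim finite_subset[rotated]) auto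
qed

lemma infnorm_axis: "infnorm (axis i s :: real ^ 'n::finite) = \<bar>s\<bar>"
proof (rule antisym)
  show "infnorm (axis i s :: real ^ 'n) \<le> \<bar>s\<bar>" by (auto simp: infnorm_le_iff axis_def)
  show "\<bar>s\<bar> \<le> infnorm (axis i s :: real ^ 'n)"
    using component_le_infnorm_cart[of "axis i s :: real ^ 'n" i] by (simp add: axis_def)
qed

section \<open>Small divisors\<close>

lemma finite_freq_lattice: "finite (freq_lattice \<omega> Q)"
  by (rule finite_subset[OF _ finite_bounded_int_vectors[of Q]]) (auto simp: freq_lattice_def)

lemma freq_lattice_mono: "Q \<le> Q' \<Longrightarrow> freq_lattice \<omega> Q \<subseteq> freq_lattice \<omega> Q'"
  by (auto simp: freq_lattice_def)

lemma freq_lattice_inner_nz: "k \<in> freq_lattice \<omega> Q \<Longrightarrow> k \<bullet> \<omega> \<noteq> 0"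
  by (rule rat_hull_nonresonant) (auto simp: freq_lattice_def infnorm_0)

lemma Psi_eqI:
  assumes "l \<in> freq_lattice \<omega> Q" "\<And>k. k \<in> freq_lattice \<omega> Q \<Longrightarrow> \<bar>l \<bullet> \<omega>\<bar> \<le> \<bar>k \<bullet> \<omega>\<bar>"
  shows "Psi \<omega> Q = inverse \<bar>l \<bullet> \<omega>\<bar>"
  unfolding Psi_def
proof (rule Max_eqI)
  fix y assume "y \<in> (\<lambda>k. inverse \<bar>k \<bullet> \<omega>\<bar>) ` freq_lattice \<omega> Q"
  then show "y \<le> inverse \<bar>l \<bullet> \<omega>\<bar>"
    using assms freq_lattice_inner_nz[OF assms(1)] by (auto intro!: le_imp_inverse_le)
qed (use assms finite_freq_lattice in auto)

lemma Psi_pos: "freq_lattice \<omega> Q \<noteq> {} \<Longrightarrow> Psi \<omega> Q > 0"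
  unfolding Psi_def
  by (subst Max_gr_iff) (auto simp: finite_freq_lattice dest: freq_lattice_inner_nz)

lemma Psi_mono: "freq_lattice \<omega> Q \<noteq> {} \<Longrightarrow> Q \<le> Q' \<Longrightarrow> Psi \<omega> Q \<le> Psi \<omega> Q'"
  unfolding Psi_def
  by (intro Max_mono image_mono freq_lattice_mono) (auto simp: finite_freq_lattice)

text \<open>Monotonicity of \<open>Psi\<close> turns strict through the factor \<open>Q\<close>.  This makes \<open>Delta_star\<close> an exact left
  inverse of \<open>Delta\<close>, although \<open>Psi\<close> jumps.\<close>

lemma Delta_strict_mono:
  assumes "admissible_Q \<omega> Q0" "Q0 \<le> Q" "Q < Q'"
  shows "Delta \<omega> Q < Delta \<omega> Q'"
proof -
  have ne: "freq_lattice \<omega> Q \<noteq> {}" and "Q > 0" using assms by (auto simp: admissible_Q_def)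
  have "Q * Psi \<omega> Q < Q' * Psi \<omega> Q" using Psi_pos[OF ne] assms by simp
  also have "\<dots> \<le> Q' * Psi \<omega> Q'" using Psi_mono[OF ne, of Q'] assms \<open>Q > 0\<close> by simp
  finally show ?thesis by (simp add: Delta_def)
qed

lemma Delta_star_Delta:
  assumes "admissible_Q \<omega> Q0" "Q0 \<le> Q"
  shows "Delta_star \<omega> Q0 (Delta \<omega> Q) = Q"
  unfolding Delta_star_def
proof (rule cSup_eq_maximum)
  fix y assume "y \<in> {Q'. Q0 \<le> Q' \<and> Delta \<omega> Q' \<le> Delta \<omega> Q}"
  then show "y \<le> Q" using Delta_strict_mono[OF assms, of y] by fastforce
qed (use assms in auto)

lemma small_divisor_attained:
  assumes "admissible_Q \<omega> Q0" "Q0 \<le> Q"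
  obtains l where "l \<in> freq_lattice \<omega> Q" "\<And>k. k \<in> freq_lattice \<omega> Q \<Longrightarrow> \<bar>l \<bullet> \<omega>\<bar> \<le> \<bar>k \<bullet> \<omega>\<bar>"
proof -
  have "freq_lattice \<omega> Q \<noteq> {}" using assms by (auto simp: admissible_Q_def)
  then show thesis
    using that finite_freq_lattice[of \<omega> Q]
      arg_min_if_finite[of "freq_lattice \<omega> Q" "\<lambda>k. \<bar>k \<bullet> \<omega>\<bar>"]
    by (metis linorder_not_le)
qed

section \<open>Choice of the resonant frequency\<close>

text \<open>Two independent integer vectors give two frequencies \<open>k1 \<bullet> \<omega>\<close> and \<open>k2 \<bullet> \<omega>\<close>; approximating the
  quotient of the second by the first by a fraction \<open>p / q\<close> (Dirichlet) makes the frequency of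
  \<open>q k2 - p k1\<close> small, and this combination is nonzero by independence.\<close>

lemma arbitrarily_small_divisor:
  fixes k1 k2 \<omega> :: "real ^ 'n::finite"
  assumes k1: "k1 \<in> int_vectors" "k1 \<in> rat_hull \<omega>" "k1 \<noteq> 0"
    and k2: "k2 \<in> int_vectors" "k2 \<in> rat_hull \<omega>"
    and indep: "\<And>c. k2 \<noteq> c *\<^sub>R k1" and "\<delta> > 0"
  obtains k where "k \<in> int_vectors" "k \<in> rat_hull \<omega>" "k \<noteq> 0" "\<bar>k \<bullet> \<omega>\<bar> < \<delta>"
proof -
  define a where "a = k1 \<bullet> \<omega>"
  have "a \<noteq> 0" unfolding a_def by (rule rat_hull_nonresonant[OF k1])
  obtain N :: nat where N: "real N * \<delta> > \<bar>a\<bar>" using reals_Archimedean3[OF \<open>\<delta> > 0\<close>] by blast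
  then have "N > 0" using \<open>a \<noteq> 0\<close> by (cases N) auto
  obtain p q :: int where "q > 0" and pq: "\<bar>of_int q * ((k2 \<bullet> \<omega>) / a) - of_int p\<bar> < 1 / real N"
    using Dirichlet_approx[OF \<open>N > 0\<close>] by metis
  define k where "k = of_int q *\<^sub>R k2 + of_int (- p) *\<^sub>R k1"
  have "k \<bullet> \<omega> = a * (of_int q * ((k2 \<bullet> \<omega>) / a) - of_int p)"
    using \<open>a \<noteq> 0\<close> by (simp add: k_def inner_add_left inner_diff_left a_def algebra_simps)
  then have "\<bar>k \<bullet> \<omega>\<bar> = \<bar>a\<bar> * \<bar>of_int q * ((k2 \<bullet> \<omega>) / a) - of_int p\<bar>" by (simp add: abs_mult)
  also have "\<dots> < \<bar>a\<bar> * (1 / real N)"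
    using \<open>a \<noteq> 0\<close> pq by (intro mult_strict_left_mono) auto
  also have "\<dots> < \<delta>" using N \<open>N > 0\<close> by (simp add: field_simps)
  finally have "\<bar>k \<bullet> \<omega>\<bar> < \<delta>" .
  moreover have "k \<in> int_vectors" unfolding k_def
    by (intro int_vectors_add int_vectors_scaleR k1 k2 Ints_of_int)
  moreover have "k \<in> rat_hull \<omega>" unfolding k_def
    by (intro subspace_add subspace_scale subspace_rat_hull k1 k2)
  moreover have "k \<noteq> 0"
  proof
    assume "k = 0"
    then have "k2 = (of_int p / of_int q) *\<^sub>R k1" using \<open>q > 0\<close>
      by (simp add: k_def vec_eq_iff field_simps)
    then show False using indep by blast
  qed
  ultimately show thesis using that by blast
qed

text \<open>If small divisors come arbitrarily close to zero, a lattice vector with a smaller divisor than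
  all those of size at most \<open>M\<close> exists.  Minimising the divisor over all lattice vectors that are not
  longer gives a vector that also realises \<open>Psi\<close> at its own length, and it must still be longer
  than \<open>M\<close>.\<close>

lemma record_divisor:
  assumes adm: "admissible_Q \<omega> Q0" and "Q0 \<le> M"
    and small: "\<And>\<delta>. \<delta> > 0 \<Longrightarrow> \<exists>k. k \<in> int_vectors \<and> k \<in> rat_hull \<omega> \<and> k \<noteq> 0 \<and> \<bar>k \<bullet> \<omega>\<bar> < \<delta>"
  obtains l where "l \<in> int_vectors" "l \<in> rat_hull \<omega>" "infnorm l > M"
    "Psi \<omega> (infnorm l) = inverse \<bar>l \<bullet> \<omega>\<bar>"
proof -
  obtain m where m: "m \<in> freq_lattice \<omega> M"
      "\<And>k. k \<in> freq_lattice \<omega> M \<Longrightarrow> \<bar>m \<bullet> \<omega>\<bar> \<le> \<bar>k \<bullet> \<omega>\<bar>"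
    using small_divisor_attained[OF adm \<open>Q0 \<le> M\<close>] by metis
  then have "\<bar>m \<bullet> \<omega>\<bar> > 0" using freq_lattice_inner_nz by auto
  then obtain k where k: "k \<in> int_vectors" "k \<in> rat_hull \<omega>" "k \<noteq> 0" "\<bar>k \<bullet> \<omega>\<bar> < \<bar>m \<bullet> \<omega>\<bar>"
    using small by blast
  then have kk: "k \<in> freq_lattice \<omega> (infnorm k)" by (simp add: freq_lattice_def infnorm_pos_lt)
  have "infnorm k > M"
  proof (rule ccontr)
    assume "\<not> infnorm k > M"
    then have "k \<in> freq_lattice \<omega> M" using kk freq_lattice_mono[of "infnorm k" M] by auto
    then show False using m k by fastforce
  qed
  then obtain l where l: "l \<in> freq_lattice \<omega> (infnorm k)"
      "\<And>k'. k' \<in> freq_lattice \<omega> (infnorm k) \<Longrightarrow> \<bar>l \<bullet> \<omega>\<bar> \<le> \<bar>k' \<bullet> \<omega>\<bar>"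
    using small_divisor_attained[OF adm, of "infnorm k"] \<open>Q0 \<le> M\<close> by (metis less_imp_le order_trans)
  have ll: "l \<in> freq_lattice \<omega> (infnorm l)" using l(1) by (simp add: freq_lattice_def)
  have "infnorm l > M"
  proof (rule ccontr)
    assume "\<not> infnorm l > M"
    then have "l \<in> freq_lattice \<omega> M" using ll freq_lattice_mono[of "infnorm l" M] by auto
    then show False using m k l(2)[OF kk] by fastforce
  qed
  moreover have "Psi \<omega> (infnorm l) = inverse \<bar>l \<bullet> \<omega>\<bar>"
  proof (rule Psi_eqI[OF ll])
    fix k' assume "k' \<in> freq_lattice \<omega> (infnorm l)"
    moreover have "infnorm l \<le> infnorm k" using l(1) by (simp add: freq_lattice_def)
    ultimately show "\<bar>l \<bullet> \<omega>\<bar> \<le> \<bar>k' \<bullet> \<omega>\<bar>" using l(2) freq_lattice_mono by blast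
  qed
  ultimately show thesis using l(1) by (intro that[of l]) (auto simp: freq_lattice_def)
qed

lemma orthogonal_int_vector:
  fixes k :: "real ^ 'n::finite"
  assumes "CARD('n) \<ge> 2" "k \<in> int_vectors" "k \<noteq> 0"
  obtains k' where "k' \<in> int_vectors" "k' \<noteq> 0" "k' \<bullet> k = 0"
proof -
  obtain i where i: "k $ i \<noteq> 0" using assms(3) by (auto simp: vec_eq_iff)
  have "UNIV \<noteq> {i}" using assms(1) by (metis card.empty card.insert empty_iff finite.emptyI
        not_less_eq_eq numeral_2_eq_2 le_numeral_extra(4) One_nat_def)
  then obtain j where j: "j \<noteq> i" by auto
  define k' where "k' = axis i (k $ j) - axis j (k $ i)"
  have "k' $ j \<noteq> 0" using i j by (simp add: k'_def axis_def)
  moreover have "k' \<in> int_vectors" using assms(2) by (auto simp: k'_def int_vectors_def axis_def)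
  moreover have "k' \<bullet> k = 0"
    by (simp add: k'_def inner_diff_left inner_axis')
  ultimately show thesis using that by (metis zero_index)
qed

text \<open>The frequency vector \<open>k\<close> of the perturbation and its orthogonal projection \<open>kF\<close> onto the
  rational hull.  The action drifts along \<open>k\<close>, and \<open>kF\<close> is the visible direction of the drift.  The
  condition on \<open>Psi\<close> says \<open>Delta \<omega> (infnorm k) = infnorm k / \<bar>k \<bullet> \<omega>\<bar>\<close>, the inverse of the size of
  perturbation needed to make \<open>k\<close> resonant.  The bound on \<open>infnorm kF\<close> keeps the speed of the
  projected drift within a factor \<open>infnorm k\<close> of the amplitude, which exponential decay absorbs.\<close>

definition drift_pair :: "real ^ 'n::finite \<Rightarrow> real ^ 'n \<Rightarrow> real ^ 'n \<Rightarrow> bool" where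
  "drift_pair \<omega> k kF \<longleftrightarrow>
     k \<in> int_vectors \<and> k \<bullet> \<omega> \<noteq> 0 \<and> Psi \<omega> (infnorm k) = inverse \<bar>k \<bullet> \<omega>\<bar> \<and>
     kF \<in> int_vectors \<and> kF \<noteq> 0 \<and> infnorm kF \<le> infnorm k \<and>
     kF \<in> rat_hull \<omega> \<and> (\<forall>z\<in>rat_hull \<omega>. orthogonal (k - kF) z)"

text \<open>On a line the divisors of lattice vectors are bounded below, and \<open>Psi\<close> is constant, equal to
  its value at the shortest lattice vector \<open>l\<close>.  No long vector of the line realises it, but adding to
  \<open>l\<close> a large multiple of an integer vector orthogonal to the line gives a long vector with the
  divisor of \<open>l\<close> and with projection \<open>l\<close>.  This is where dimension at least two enters.\<close>

lemma record_divisor_line: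
  fixes \<omega> :: "real ^ 'n::finite"
  assumes n: "CARD('n) \<ge> 2" and adm: "admissible_Q \<omega> Q0" and "Q0 \<le> M"
    and line: "rat_hull \<omega> \<subseteq> span {b}"
  obtains k kF where "drift_pair \<omega> k kF" "infnorm k > M"
proof -
  obtain l where l: "l \<in> freq_lattice \<omega> Q0" and
      lmin: "\<And>k. k \<in> freq_lattice \<omega> Q0 \<Longrightarrow> \<bar>l \<bullet> \<omega>\<bar> \<le> \<bar>k \<bullet> \<omega>\<bar>"
    using small_divisor_attained[OF adm, of Q0] by auto
  have lF: "l \<in> int_vectors" "l \<in> rat_hull \<omega>" "l \<noteq> 0" "infnorm l \<le> Q0"
    using l by (auto simp: freq_lattice_def infnorm_0)
  have multiple: "\<exists>c. z = c *\<^sub>R l" if "z \<in> rat_hull \<omega>" for z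
  proof -
    obtain r s where r: "l = r *\<^sub>R b" and s: "z = s *\<^sub>R b"
      using line lF(2) \<open>z \<in> rat_hull \<omega>\<close> unfolding span_singleton by blast
    then have "r \<noteq> 0" using lF by auto
    then have "z = (s / r) *\<^sub>R l" using r s by simp
    then show ?thesis by blast
  qed
  \<comment> \<open>On a line, divisors are proportional to lengths, so a vector with a smaller divisor would be
    shorter than \<open>l\<close> and compete with it below \<open>Q0\<close>.\<close>
  have min: "\<bar>l \<bullet> \<omega>\<bar> \<le> \<bar>k \<bullet> \<omega>\<bar>" if k: "k \<in> freq_lattice \<omega> Q" for k Q
  proof (rule ccontr)
    assume less: "\<not> \<bar>l \<bullet> \<omega>\<bar> \<le> \<bar>k \<bullet> \<omega>\<bar>"
    obtain c where c: "k = c *\<^sub>R l" using multiple k by (auto simp: freq_lattice_def)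
    then have "\<bar>c\<bar> * \<bar>l \<bullet> \<omega>\<bar> < 1 * \<bar>l \<bullet> \<omega>\<bar>" using less by (simp add: abs_mult)
    then have "\<bar>c\<bar> < 1" by (metis abs_ge_zero mult_right_less_imp_less)
    then have "infnorm k \<le> infnorm l"
      unfolding c infnorm_mul by (intro mult_left_le_one_le) (auto simp: infnorm_pos_le)
    then have "k \<in> freq_lattice \<omega> Q0" using k lF by (simp add: freq_lattice_def)
    then show False using lmin less by blast
  qed
  have Psi: "Psi \<omega> Q = inverse \<bar>l \<bullet> \<omega>\<bar>" if "Q0 \<le> Q" for Q
    using freq_lattice_mono[OF that] l min by (intro Psi_eqI) auto
  obtain k' where k': "k' \<in> int_vectors" "k' \<noteq> 0" "k' \<bullet> l = 0"
    using orthogonal_int_vector[OF n lF(1,3)] .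
  have orth: "k' \<bullet> z = 0" if "z \<in> rat_hull \<omega>" for z
    using multiple[OF that] k'(3) by auto
  obtain m :: nat where m: "real m > M + 2 * infnorm l" using reals_Archimedean2 by blast
  define k where "k = l + real m *\<^sub>R k'"
  have kw: "k \<bullet> \<omega> = l \<bullet> \<omega>" using orth[OF mem_rat_hull] by (simp add: k_def inner_add_left)
  have "real m \<le> real m * infnorm k'"
    using int_vectors_infnorm_ge_1[OF k'(1,2)] by (simp add: mult_le_cancel_left1)
  also have "\<dots> = infnorm (k - l)" by (simp add: k_def infnorm_mul)
  also have "\<dots> \<le> infnorm k + infnorm l"
    using infnorm_triangle[of k "- l"] by (simp add: infnorm_neg)
  finally have big: "infnorm k > M + infnorm l" using m by linarith
  have Q0: "Q0 > 0" using adm by (simp add: admissible_Q_def)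
  show thesis
  proof (rule that[of k l])
    have "k \<in> int_vectors" unfolding k_def
      by (intro int_vectors_add int_vectors_scaleR lF k') auto
    moreover have "orthogonal (k - l) z" if "z \<in> rat_hull \<omega>" for z
      using orth[OF that] by (simp add: k_def orthogonal_def)
    moreover show "infnorm k > M" using big infnorm_pos_le[of l] by linarith
    moreover have "infnorm l \<le> infnorm k" using big \<open>Q0 \<le> M\<close> Q0 by linarith
    moreover have "Psi \<omega> (infnorm k) = inverse \<bar>k \<bullet> \<omega>\<bar>"
      using Psi[of "infnorm k"] kw \<open>Q0 \<le> M\<close> \<open>infnorm k > M\<close> by simp
    moreover have "k \<bullet> \<omega> \<noteq> 0" using kw freq_lattice_inner_nz[OF l] by simp
    ultimately show "drift_pair \<omega> k l" using lF by (simp add: drift_pair_def)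
  qed
qed

text \<open>When the rational hull has dimension at least two, a record vector of the lattice itself serves,
  with \<open>kF = k\<close>.\<close>

lemma drift_frequency:
  fixes \<omega> :: "real ^ 'n::finite"
  assumes n: "CARD('n) \<ge> 2" and adm: "admissible_Q \<omega> Q0" and "Q0 \<le> M"
  obtains k kF where "drift_pair \<omega> k kF" "infnorm k > M"
proof (cases "\<exists>b. rat_hull \<omega> \<subseteq> span {b}")
  case True
  then show thesis using record_divisor_line[OF n adm \<open>Q0 \<le> M\<close>] that by blast
next
  case False
  obtain B where B: "span B = rat_hull \<omega>" "\<forall>b\<in>B. rational_vector b"
    using rational_rat_hull[of \<omega>] unfolding rational_subspace_def rational_vector_def by blast
  have "\<not> B \<subseteq> {0}"
  proof
    assume "B \<subseteq> {0}"
    then have "span B \<subseteq> span {0}" by (rule span_mono)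
    then show False using False B(1) by blast
  qed
  then obtain b1 where b1: "b1 \<in> B" "b1 \<noteq> 0" by auto
  have "\<not> B \<subseteq> span {b1}"
  proof
    assume "B \<subseteq> span {b1}"
    then have "span B \<subseteq> span {b1}" by (metis span_mono span_span)
    then show False using False B by auto
  qed
  then obtain b2 where b2: "b2 \<in> B" "b2 \<notin> span {b1}" by auto
  obtain q1 q2 :: real where q: "q1 > 0" "q1 *\<^sub>R b1 \<in> int_vectors" "q2 > 0" "q2 *\<^sub>R b2 \<in> int_vectors"
    using rational_vector_int_multiple B(2) b1(1) b2(1) by metis
  have F: "q1 *\<^sub>R b1 \<in> rat_hull \<omega>" "q2 *\<^sub>R b2 \<in> rat_hull \<omega>"
    using B(1) b1 b2 by (auto intro: span_scale span_base)
  have "q2 *\<^sub>R b2 \<noteq> c *\<^sub>R (q1 *\<^sub>R b1)" for c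
  proof
    assume "q2 *\<^sub>R b2 = c *\<^sub>R (q1 *\<^sub>R b1)"
    then have "b2 = (inverse q2 * c * q1) *\<^sub>R b1"
      using q(3) by (metis scaleR_scaleR scaleR_one left_inverse less_irrefl)
    then show False using b2 by (auto simp: span_singleton)
  qed
  then have "\<exists>k. k \<in> int_vectors \<and> k \<in> rat_hull \<omega> \<and> k \<noteq> 0 \<and> \<bar>k \<bullet> \<omega>\<bar> < \<delta>" if "\<delta> > 0" for \<delta>
    using arbitrarily_small_divisor[of "q1 *\<^sub>R b1" \<omega> "q2 *\<^sub>R b2" \<delta>] q F b1 that
    by (metis scaleR_eq_0_iff less_irrefl)
  then obtain l where l: "l \<in> int_vectors" "l \<in> rat_hull \<omega>" "infnorm l > M"
      "Psi \<omega> (infnorm l) = inverse \<bar>l \<bullet> \<omega>\<bar>"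
    using record_divisor[OF adm \<open>Q0 \<le> M\<close>] by metis
  have "Q0 > 0" using adm by (simp add: admissible_Q_def)
  then have "l \<noteq> 0" using l(3) \<open>Q0 \<le> M\<close> by (auto simp: infnorm_0)
  then show thesis using l rat_hull_nonresonant[OF l(1,2)]
    by (intro that[of l l]) (auto simp: drift_pair_def orthogonal_def)
qed

section \<open>Gevrey norms of plane waves\<close>

text \<open>The constant \<open>c\<close> and the phase shift \<open>\<phi>\<close> make this class of functions closed under partial
  derivatives: differentiating the cosine shifts its phase by a quarter turn, and differentiating
  the linear part leaves a constant.\<close>

definition wave :: "real ^ 'n::finite \<Rightarrow> real ^ 'n \<Rightarrow> real \<Rightarrow> real \<Rightarrow> real \<Rightarrow> 'n phase \<Rightarrow> real" where
  "wave k u c A \<phi> z = u \<bullet> snd z + c + A * cos (2 * pi * (k \<bullet> fst z) + \<phi>)"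

definition wave_partial ::
    "real ^ 'n::finite \<Rightarrow> real ^ 'n \<Rightarrow> real \<Rightarrow> real \<Rightarrow> 'n + 'n \<Rightarrow> 'n phase \<Rightarrow> real" where
  "wave_partial k u A \<phi> i = (case i of
     Inl j \<Rightarrow> wave k 0 0 (A * (2 * pi * k $ j)) (\<phi> + pi / 2)
   | Inr j \<Rightarrow> wave k 0 (u $ j) 0 \<phi>)"

text \<open>Vector derivatives within a set are unique only at limit points of the set; on the faces of the
  cube this uses \<open>R > 0\<close>.\<close>

lemma slice_not_bot:
  fixes z :: "'n::finite phase"
  assumes "R > 0" "z \<in> phase_domain R"
  shows "at 0 within {h. z + h *\<^sub>R coord_dir i \<in> phase_domain R} \<noteq> bot"
proof (cases i)
  case (Inl j)
  then have "{h. z + h *\<^sub>R coord_dir i \<in> phase_domain R} = UNIV"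
    using assms by (cases z) (auto simp: phase_domain_def coord_dir_def)
  then show ?thesis by simp
next
  case (Inr j)
  define a where "a = snd z $ j"
  have I: "\<bar>snd z $ l\<bar> \<le> R" for l
    using assms(2) by (auto simp: phase_domain_def infnorm_le_iff)
  have "{- R - a..R - a} \<subseteq> {h. z + h *\<^sub>R coord_dir i \<in> phase_domain R}"
    using I Inr
    by (cases z) (auto simp: phase_domain_def coord_dir_def infnorm_le_iff axis_def a_def abs_le_iff)
  moreover have "(0::real) islimpt {- R - a..R - a}"
    using I[of j] assms(1) by (subst islimpt_Icc) (auto simp: a_def abs_le_iff)
  ultimately show ?thesis
    using islimpt_subset trivial_limit_within by blast
qed

lemma wave_has_vector_derivative:
  "((\<lambda>h. wave k u c A \<phi> (z + h *\<^sub>R coord_dir i)) has_vector_derivative wave_partial k u A \<phi> i z)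
     (at 0 within S)"
proof (cases i)
  case (Inl j)
  have "((\<lambda>h. u \<bullet> snd z + c + A * cos (2 * pi * (k \<bullet> fst z + h * k $ j) + \<phi>)) has_real_derivative
     A * (2 * pi * k $ j) * cos (2 * pi * (k \<bullet> fst z) + (\<phi> + pi / 2))) (at 0 within S)"
    by (auto intro!: derivative_eq_intros simp: cos_add sin_add algebra_simps)
  then show ?thesis
    by (simp add: Inl wave_def wave_partial_def coord_dir_def inner_add_right inner_axis
        has_real_derivative_iff_has_vector_derivative)
next
  case (Inr j)
  have "((\<lambda>h. u \<bullet> snd z + h * u $ j + c + A * cos (2 * pi * (k \<bullet> fst z) + \<phi>)) has_real_derivative
     u $ j) (at 0 within S)"
    by (auto intro!: derivative_eq_intros)
  then show ?thesis
    by (simp add: Inr wave_def wave_partial_def coord_dir_def inner_add_right inner_axis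
        has_real_derivative_iff_has_vector_derivative)
qed

lemma partial_on_wave:
  assumes "R > 0" and g: "\<And>z. z \<in> phase_domain R \<Longrightarrow> g z = wave k u c A \<phi> z"
    and z: "z \<in> phase_domain R"
  shows "partial_on (phase_domain R) i g z = wave_partial k u A \<phi> i z"
    and "(\<lambda>h. g (z + h *\<^sub>R coord_dir i)) differentiable
      (at 0 within {h. z + h *\<^sub>R coord_dir i \<in> phase_domain R})"
proof -
  let ?S = "{h. z + h *\<^sub>R coord_dir i \<in> phase_domain R}"
  have *: "((\<lambda>h. g (z + h *\<^sub>R coord_dir i)) has_vector_derivative wave_partial k u A \<phi> i z) (at 0 within ?S)"
    by (rule has_vector_derivative_transform[OF _ _ wave_has_vector_derivative[of k u c A \<phi>]])
       (use z g in auto)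
  show "partial_on (phase_domain R) i g z = wave_partial k u A \<phi> i z"
    unfolding partial_on_def by (rule vector_derivative_within[OF slice_not_bot * ]) (use assms in auto)
  show "(\<lambda>h. g (z + h *\<^sub>R coord_dir i)) differentiable (at 0 within ?S)"
    using * by (rule differentiableI_vector)
qed

text \<open>Each angular derivative costs a factor of at most \<open>2 * pi * infnorm k\<close> on the oscillating part.  The
  linear part contributes only to derivatives of order at most one, so it does not affect the growth
  of the derivatives.\<close>

lemma iterated_partial_wave:
  fixes k u :: "real ^ 'n::finite"
  assumes "R > 0" and g: "\<And>z. z \<in> phase_domain R \<Longrightarrow> g z = wave k u 0 A \<phi> z"
  shows "\<exists>u' c' A' \<phi>'. (\<forall>z\<in>phase_domain R. foldr (partial_on (phase_domain R)) is g z = wave k u' c' A' \<phi>' z) \<and>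
      \<bar>A'\<bar> \<le> \<bar>A\<bar> * (2 * pi * infnorm k) ^ length is \<and>
      u' = (if is = [] then u else 0) \<and>
      (if length is = 1 then \<bar>c'\<bar> \<le> infnorm u else c' = 0)"
proof (induction "is")
  case Nil
  then show ?case using g by auto
next
  case (Cons i "is")
  then obtain u' c' A' \<phi>' where
    *: "\<And>z. z \<in> phase_domain R \<Longrightarrow> foldr (partial_on (phase_domain R)) is g z = wave k u' c' A' \<phi>' z"
      "\<bar>A'\<bar> \<le> \<bar>A\<bar> * (2 * pi * infnorm k) ^ length is"
      "u' = (if is = [] then u else 0)" by blast
  have step: "foldr (partial_on (phase_domain R)) (i # is) g z = wave_partial k u' A' \<phi>' i z"
    if "z \<in> phase_domain R" for z
    using partial_on_wave(1)[OF \<open>R > 0\<close> *(1) that] by simp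
  show ?case
  proof (cases i)
    case (Inl j)
    have "\<bar>A' * (2 * pi * k $ j)\<bar> = \<bar>A'\<bar> * (2 * pi * \<bar>k $ j\<bar>)" by (simp add: abs_mult)
    also have "\<dots> \<le> (\<bar>A\<bar> * (2 * pi * infnorm k) ^ length is) * (2 * pi * infnorm k)"
      using * by (intro mult_mono mult_left_mono component_le_infnorm_cart)
        (auto simp: infnorm_pos_le intro!: mult_nonneg_nonneg)
    finally show ?thesis using step
      by (intro exI[of _ 0] exI[of _ 0] exI[of _ "A' * (2 * pi * k $ j)"] exI[of _ "\<phi>' + pi / 2"])
         (auto simp: Inl wave_partial_def mult_ac infnorm_pos_le)
  next
    case (Inr j)
    then show ?thesis using step *(3) component_le_infnorm_cart[of u j]
      by (intro exI[of _ 0] exI[of _ "u' $ j"] exI[of _ 0] exI[of _ \<phi>'])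
         (auto simp: wave_partial_def infnorm_pos_le split: if_splits)
  qed
qed

lemma smooth_fun_on_wave:
  assumes "R > 0" and g: "\<And>z. z \<in> phase_domain R \<Longrightarrow> g z = wave k u 0 A \<phi> z"
  shows "smooth_fun_on (phase_domain R) g"
  unfolding smooth_fun_on_def
proof (intro allI conjI)
  fix "is" i
  obtain u' c' A' \<phi>' where
    *: "\<And>z. z \<in> phase_domain R \<Longrightarrow> foldr (partial_on (phase_domain R)) is g z = wave k u' c' A' \<phi>' z"
    using iterated_partial_wave[of R g k u A \<phi> "is"] assms by blast
  have "continuous_on (phase_domain R) (wave k u' c' A' \<phi>')"
    unfolding wave_def by (intro continuous_intros)
  then show "continuous_on (phase_domain R) (foldr (partial_on (phase_domain R)) is g)"
    using * by (simp cong: continuous_on_cong)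
  show "partially_differentiable_on (phase_domain R) i (foldr (partial_on (phase_domain R)) is g)"
    unfolding partially_differentiable_on_def using partial_on_wave(2)[OF \<open>R > 0\<close> *] by blast
qed

lemma torus_periodic_on_wave:
  fixes k :: "real ^ 'n::finite"
  assumes "k \<in> int_vectors"
  shows "torus_periodic_on D (wave k u c A \<phi>)"
  unfolding torus_periodic_on_def
proof (intro allI ballI impI)
  fix \<theta> I l assume "l \<in> (int_vectors :: (real^'n) set)"
  then have "k \<bullet> l \<in> \<int>" using assms
    unfolding inner_vec_def int_vectors_def by (auto intro!: Ints_sum)
  then obtain m where m: "k \<bullet> l = of_int m" by (auto elim: Ints_cases)
  have "cos (2 * pi * (k \<bullet> (\<theta> + l)) + \<phi>) = cos (2 * pi * (k \<bullet> \<theta>) + \<phi> + 2 * pi * of_int m)"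
    by (simp add: inner_add_right m algebra_simps)
  also have "\<dots> = cos (2 * pi * (k \<bullet> \<theta>) + \<phi>)"
    by (subst cos_add) (simp add: cos_int_2pin sin_int_2pin)
  finally show "wave k u c A \<phi> (\<theta> + l, I) = wave k u c A \<phi> (\<theta>, I)" by (simp add: wave_def)
qed

lemma list_with_counts:
  fixes l :: "'a::finite \<Rightarrow> nat"
  obtains xs where "\<And>i. count_list xs i = l i" "length xs = (\<Sum>i\<in>UNIV. l i)"
proof -
  obtain xs where xs: "mset xs = (\<Sum>i\<in>UNIV. replicate_mset (l i) i)" using ex_mset by blast
  have c: "count_list xs i = l i" for i
  proof -
    have "count_list xs i = (\<Sum>j\<in>UNIV. if j = i then l j else 0)"
      by (simp add: xs count_sum flip: count_mset)
    then show ?thesis by simp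
  qed
  moreover have "length xs = (\<Sum>i\<in>UNIV. l i)"
    using sum_count_set[of xs UNIV] c by simp
  ultimately show thesis using that by blast
qed

lemma power_le_fact_exp:
  fixes x :: real
  assumes "x \<ge> 0"
  shows "x ^ m / fact m \<le> exp x"
proof -
  have "(\<Sum>n\<in>{m}. x ^ n /\<^sub>R fact n) \<le> (\<Sum>n. x ^ n /\<^sub>R fact n)"
    using assms by (intro sum_le_suminf summable_exp_generic) auto
  then show ?thesis by (simp add: exp_def divide_inverse mult.commute)
qed

text \<open>With \<open>y = L * x powr (1 / \<alpha>)\<close> the left side is the power \<open>\<alpha>\<close> of a product of terms
  \<open>y ^ m / fact m\<close>, one for each coordinate, and each of these is a term of the series of \<open>exp y\<close>.\<close>

lemma gevrey_weight_le:
  fixes l :: "'a::finite \<Rightarrow> nat"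
  assumes "\<alpha> > 0" "L > 0" "x > 0"
  shows "L powr (real (\<Sum>i\<in>UNIV. l i) * \<alpha>) * (\<Prod>i\<in>UNIV. fact (l i)) powr (- \<alpha>) * x ^ (\<Sum>i\<in>UNIV. l i)
    \<le> exp (\<alpha> * real CARD('a) * L * x powr (1 / \<alpha>))"
proof -
  define y where "y = L * x powr (1 / \<alpha>)"
  have y: "y > 0" "y powr \<alpha> = L powr \<alpha> * x"
    using assms by (auto simp: y_def powr_mult powr_powr)
  have "L powr (real (\<Sum>i\<in>UNIV. l i) * \<alpha>) * x ^ (\<Sum>i\<in>UNIV. l i) = (y ^ (\<Sum>i\<in>UNIV. l i)) powr \<alpha>"
  proof -
    have "L powr (real m * \<alpha>) * x ^ m = (y ^ m) powr \<alpha>" for m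
    proof -
      have "(y ^ m) powr \<alpha> = (y powr \<alpha>) ^ m"
        using y(1) by (simp add: powr_powr powr_realpow[symmetric] mult.commute)
      also have "\<dots> = (L powr \<alpha>) ^ m * x ^ m" by (simp add: y(2) power_mult_distrib)
      also have "(L powr \<alpha>) ^ m = L powr (real m * \<alpha>)"
        using assms by (simp add: powr_realpow[symmetric] powr_powr mult.commute)
      finally show ?thesis by simp
    qed
    then show ?thesis .
  qed
  then have "L powr (real (\<Sum>i\<in>UNIV. l i) * \<alpha>) * (\<Prod>i\<in>UNIV. fact (l i)) powr (- \<alpha>) * x ^ (\<Sum>i\<in>UNIV. l i)
     = (\<Prod>i\<in>UNIV. y ^ l i) powr \<alpha> / (\<Prod>i\<in>UNIV. fact (l i)) powr \<alpha>"
    by (simp add: powr_minus divide_inverse mult_ac power_sum)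
  also have "\<dots> = (\<Prod>i\<in>UNIV. y ^ l i / fact (l i)) powr \<alpha>"
    using y by (simp add: powr_divide prod_nonneg prod_dividef)
  also have "\<dots> \<le> (\<Prod>i\<in>(UNIV::'a set). exp y) powr \<alpha>"
    using y assms by (intro powr_mono2 prod_mono conjI power_le_fact_exp prod_nonneg) auto
  also have "\<dots> = exp (\<alpha> * real CARD('a) * L * x powr (1 / \<alpha>))"
    by (simp add: powr_def y_def exp_of_nat_mult[symmetric] mult_ac)
  finally show ?thesis .
qed

text \<open>The exponential is the price of the frequency \<open>k\<close> in the Gevrey norm; it dictates how small the
  amplitude of the oscillating part has to be.\<close>

lemma gevrey_term_wave_le:
  fixes k u :: "real ^ 'n::finite"
  assumes "R > 0" "\<alpha> > 0" "L > 0" "infnorm k > 0"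
    and U: "\<And>I. infnorm I \<le> R \<Longrightarrow> \<bar>u \<bullet> I\<bar> \<le> U"
  shows "gevrey_term \<alpha> L (phase_domain R) (wave k u 0 A \<phi>) l
    \<le> \<bar>A\<bar> * exp (\<alpha> * real CARD('n + 'n) * L * (2 * pi * infnorm k) powr (1 / \<alpha>))
      + (U + L powr \<alpha> * infnorm u)"
proof -
  let ?D = "phase_domain R :: 'n phase set"
  let ?x = "2 * pi * infnorm k"
  let ?g = "wave k u 0 A \<phi>"
  define m where "m = (\<Sum>i\<in>UNIV. l i)"
  define W where "W = L powr (real m * \<alpha>) * (\<Prod>i\<in>UNIV. fact (l i)) powr (- \<alpha>)"
  define P where "P = (if m = 0 then U else if m = 1 then infnorm u else 0)"
  define xs where "xs = (SOME is. \<forall>i. count_list is i = l i)"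
  have "\<forall>i. count_list xs i = l i"
    unfolding xs_def by (rule someI_ex) (metis list_with_counts)
  then have len: "length xs = m"
    using sum_count_set[of xs UNIV] by (simp add: m_def)
  have U0: "U \<ge> 0" using U[of 0] assms(1) by (simp add: infnorm_0)
  obtain u' c' A' \<phi>' where
    *: "\<And>z. z \<in> ?D \<Longrightarrow> foldr (partial_on ?D) xs ?g z = wave k u' c' A' \<phi>' z"
      "\<bar>A'\<bar> \<le> \<bar>A\<bar> * ?x ^ m" "u' = (if m = 0 then u else 0)"
      "if m = 1 then \<bar>c'\<bar> \<le> infnorm u else c' = 0"
    using iterated_partial_wave[OF \<open>R > 0\<close>, of ?g k u A \<phi> xs] len by (metis length_0_conv)
  have bound: "\<bar>foldr (partial_on ?D) xs ?g z\<bar> \<le> \<bar>A\<bar> * ?x ^ m + P" if z: "z \<in> ?D" for z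
  proof -
    have "\<bar>foldr (partial_on ?D) xs ?g z\<bar> \<le> \<bar>u' \<bullet> snd z + c'\<bar> + \<bar>A'\<bar> * \<bar>cos (2 * pi * (k \<bullet> fst z) + \<phi>')\<bar>"
      using *(1)[OF z] by (simp add: wave_def abs_mult abs_triangle_ineq flip: abs_mult)
    also have "\<bar>A'\<bar> * \<bar>cos (2 * pi * (k \<bullet> fst z) + \<phi>')\<bar> \<le> \<bar>A'\<bar>"
      by (intro mult_left_le) auto
    also have "\<bar>u' \<bullet> snd z + c'\<bar> \<le> P"
      using *(3,4) U[of "snd z"] z by (auto simp: P_def phase_domain_def split: if_splits)
    finally show ?thesis using *(2) by simp
  qed
  have "0 \<in> ?D" using assms(1) by (simp add: phase_domain_def zero_prod_def infnorm_0)
  then have "C0_norm_on ?D (multi_partial_on ?D l ?g) \<le> \<bar>A\<bar> * ?x ^ m + P"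
    unfolding C0_norm_on_def multi_partial_on_def xs_def[symmetric]
    by (intro cSUP_least bound) auto
  then have "gevrey_term \<alpha> L ?D ?g l \<le> W * (\<bar>A\<bar> * ?x ^ m + P)"
    unfolding gevrey_term_def m_def[symmetric] W_def
    by (intro mult_left_mono) auto
  also have "\<dots> = \<bar>A\<bar> * (W * ?x ^ m) + W * P" by (simp add: algebra_simps)
  also have "W * ?x ^ m \<le> exp (\<alpha> * real CARD('n + 'n) * L * ?x powr (1 / \<alpha>))"
    unfolding W_def m_def by (rule gevrey_weight_le) (use assms in auto)
  also have "W * P \<le> U + L powr \<alpha> * infnorm u"
  proof -
    have "(\<Prod>i\<in>UNIV. fact (l i)) \<ge> (1::real)" by (intro prod_ge_1) auto
    then have "(\<Prod>i\<in>UNIV. fact (l i) :: real) powr (- \<alpha>) \<le> 1"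
      using assms(2) by (simp add: powr_minus ge_one_powr_ge_zero inverse_le_1_iff)
    then have "W \<le> L powr (real m * \<alpha>)" unfolding W_def by (intro mult_left_le) auto
    then have "W * P \<le> L powr (real m * \<alpha>) * P"
      using U0 by (intro mult_right_mono) (auto simp: P_def infnorm_pos_le)
    also have "\<dots> \<le> U + L powr \<alpha> * infnorm u"
      using U0 assms(3) by (auto simp: P_def infnorm_pos_le)
    finally show ?thesis .
  qed
  finally show ?thesis by (simp add: mult_left_mono)
qed

lemma gevrey_term_0:
  assumes "L > 0"
  shows "gevrey_term \<alpha> L D f (\<lambda>_. 0) = C0_norm_on D f"
proof -
  have "(SOME is::('a + 'a) list. \<forall>i. count_list is i = 0) = []"
    by (rule some_equality) (auto simp: count_list_0_iff)
  then show ?thesis using assms by (simp add: gevrey_term_def multi_partial_on_def)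
qed

text \<open>The amplitude \<open>A\<close> is chosen so that the oscillating part has Gevrey norm at most \<open>\<bar>s\<bar>\<close>, the size of
  the linear part.  The lower bound on the norm is read off from the value of \<open>f\<close> at a point of a
  face of the cube, where the linear part is maximal, with angles for which the cosine is \<open>1\<close>.\<close>

lemma gevrey_wave:
  fixes k :: "real ^ 'n::finite" and i :: 'n
  assumes "R > 0" "\<alpha> > 0" "L > 0" and k: "k \<in> int_vectors" "k \<noteq> 0" and "s \<noteq> 0"
  defines "A \<equiv> \<bar>s\<bar> * exp (- (\<alpha> * real CARD('n + 'n) * L * (2 * pi) powr (1 / \<alpha>)) * infnorm k powr (1 / \<alpha>))"
  defines "f \<equiv> wave k (axis i s) 0 A 0"
  shows "f \<in> gevrey_class \<alpha> L (phase_domain R)"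
    and "R * \<bar>s\<bar> \<le> gevrey_norm \<alpha> L (phase_domain R) f"
    and "gevrey_norm \<alpha> L (phase_domain R) f \<le> (1 + R + L powr \<alpha>) * \<bar>s\<bar>"
proof -
  let ?D = "phase_domain R :: 'n phase set"
  have "A > 0" using \<open>s \<noteq> 0\<close> by (simp add: A_def)
  have kpos: "infnorm k > 0" using k by (simp add: infnorm_pos_lt)
  have U: "\<bar>axis i s \<bullet> I\<bar> \<le> R * \<bar>s\<bar>" if "infnorm I \<le> R" for I :: "real ^ 'n"
    using that component_le_infnorm_cart[of I i]
    by (simp add: inner_axis' abs_mult mult.commute[of R] mult_left_mono)
  have "\<bar>A\<bar> * exp (\<alpha> * real CARD('n + 'n) * L * (2 * pi * infnorm k) powr (1 / \<alpha>)) = \<bar>s\<bar>"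
    using kpos by (simp add: A_def abs_mult powr_mult mult.assoc flip: exp_add)
  then have le: "gevrey_term \<alpha> L ?D f l \<le> (1 + R + L powr \<alpha>) * \<bar>s\<bar>" for l
    using gevrey_term_wave_le[OF assms(1-3) kpos U, of A 0 l]
    by (simp add: f_def infnorm_axis algebra_simps)
  have bdd: "bdd_above (range (gevrey_term \<alpha> L ?D f))" by (rule bdd_aboveI2[OF le])
  have "smooth_fun_on ?D f" by (rule smooth_fun_on_wave) (auto simp: f_def assms(1))
  then show "f \<in> gevrey_class \<alpha> L ?D"
    using bdd torus_periodic_on_wave[OF k(1)] by (simp add: gevrey_class_def f_def)
  show "gevrey_norm \<alpha> L ?D f \<le> (1 + R + L powr \<alpha>) * \<bar>s\<bar>"
    unfolding gevrey_norm_def by (rule cSUP_least) (use le in auto)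
  define z :: "'n phase" where "z = (0, axis i (sgn s * R))"
  have z: "z \<in> ?D"
    using \<open>s \<noteq> 0\<close> assms(1) by (simp add: z_def phase_domain_def infnorm_axis abs_mult)
  have "f z = R * \<bar>s\<bar> + A"
    by (simp add: f_def wave_def z_def inner_axis' abs_sgn mult_ac)
  then have "R * \<bar>s\<bar> \<le> \<bar>f z\<bar>" using \<open>A > 0\<close> by linarith
  also have "\<dots> \<le> C0_norm_on ?D f"
    unfolding C0_norm_on_def
  proof (rule cSUP_upper[OF z])
    have "\<bar>f z\<bar> \<le> R * \<bar>s\<bar> + A" if "z \<in> ?D" for z
    proof -
      have "\<bar>f z\<bar> \<le> \<bar>axis i s \<bullet> snd z\<bar> + \<bar>A\<bar> * \<bar>cos (2 * pi * (k \<bullet> fst z))\<bar>"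
        by (simp add: f_def wave_def flip: abs_mult)
      moreover have "\<bar>A\<bar> * \<bar>cos (2 * pi * (k \<bullet> fst z))\<bar> \<le> \<bar>A\<bar>" by (intro mult_left_le) auto
      moreover have "\<bar>axis i s \<bullet> snd z\<bar> \<le> R * \<bar>s\<bar>"
        using that by (intro U) (auto simp: phase_domain_def)
      ultimately show ?thesis using \<open>A > 0\<close> by linarith
    qed
    then show "bdd_above ((\<lambda>z. \<bar>f z\<bar>) ` ?D)" by (auto intro!: bdd_aboveI)
  qed
  also have "\<dots> = gevrey_term \<alpha> L ?D f (\<lambda>_. 0)" using gevrey_term_0[OF assms(3)] by metis
  also have "\<dots> \<le> gevrey_norm \<alpha> L ?D f"
    unfolding gevrey_norm_def by (rule cSUP_upper) (use bdd in auto)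
  finally show "R * \<bar>s\<bar> \<le> gevrey_norm \<alpha> L ?D f" .
qed

section \<open>Linear drift at an exact resonance\<close>

text \<open>Resonance makes the phase \<open>k \<bullet> \<theta>\<close> a constant of motion, so the force is constant, and it is maximal
  for the phase \<open>1 / 4\<close>.  The angular velocity is the same at every point of the domain, hence any
  extension of the solution has the same angles, then the same force and the same actions; it cannot
  outlive the exit of the straight line \<open>I\<close> from the cube.\<close>

lemma resonant_wave_solution:
  fixes k v :: "real ^ 'n::finite"
  assumes "R > 0" "A > 0" "k \<noteq> 0" and res: "k \<bullet> v = 0"
  defines "H \<equiv> wave k v 0 A 0" and "I \<equiv> \<lambda>t. (2 * pi * A * t) *\<^sub>R k"
  shows "\<exists>J \<theta>. 0 \<in> interior J \<and> maximal_hamiltonian_solution (phase_domain R) H J \<theta> I"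
proof -
  let ?D = "phase_domain R :: 'n phase set"
  define \<theta> where "\<theta> t = (1 / (4 * (k \<bullet> k))) *\<^sub>R k + t *\<^sub>R v" for t
  define J where "J = {t. infnorm (I t) \<le> R}"
  define X where "X = 2 * pi * A * infnorm k"
  define T where "T = R / X"
  have kpos: "infnorm k > 0" using \<open>k \<noteq> 0\<close> by (simp add: infnorm_pos_lt)
  have "X > 0" using \<open>A > 0\<close> kpos by (simp add: X_def)
  have "infnorm (I t) = \<bar>t\<bar> * X" for t
    using \<open>A > 0\<close> by (simp add: I_def X_def infnorm_mul abs_mult)
  then have "infnorm (I t) \<le> R \<longleftrightarrow> \<bar>t\<bar> \<le> T" for t
    using pos_le_divide_eq[OF \<open>X > 0\<close>, of "\<bar>t\<bar>" R] unfolding T_def by metis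
  then have "J = {t. \<bar>t\<bar> \<le> T}" unfolding J_def by blast
  also have "\<dots> = {- T..T}" by auto
  finally have J: "J = {- T..T}" .
  have "T > 0" using assms \<open>X > 0\<close> by (simp add: T_def)
  have phase: "k \<bullet> \<theta> t = 1 / 4" for t
    using \<open>k \<noteq> 0\<close> by (simp add: \<theta>_def inner_add_right res)
  have vH: "(\<chi> i. partial_on ?D (Inr i) H z) = v" if "z \<in> ?D" for z
    using partial_on_wave(1)[OF \<open>R > 0\<close> _ that, of H k v 0 A 0]
    by (simp add: H_def wave_partial_def wave_def vec_eq_iff)
  have kH: "(\<chi> i. - partial_on ?D (Inl i) H z) = (2 * pi * A) *\<^sub>R k" if "z \<in> ?D" "k \<bullet> fst z = 1 / 4" for z
  proof -
    have "wave k 0 0 B (pi / 2) z = - B" for B unfolding wave_def that(2) by (simp add: cos_add)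
    then show ?thesis
      using partial_on_wave(1)[OF \<open>R > 0\<close> _ that(1), of H k v 0 A 0]
      by (simp add: H_def wave_partial_def vec_eq_iff mult_ac)
  qed
  have sol: "hamiltonian_solution ?D H J \<theta> I"
    unfolding hamiltonian_solution_def
  proof (intro conjI ballI)
    show "is_interval J" unfolding J by (rule is_interval_cc)
    fix t assume "t \<in> J"
    then show D: "(\<theta> t, I t) \<in> ?D" by (simp add: phase_domain_def J_def)
    show "(\<theta> has_vector_derivative (\<chi> i. partial_on ?D (Inr i) H (\<theta> t, I t))) (at t within J)"
    proof -
      have "(\<theta> has_vector_derivative v) (at t within J)"
        unfolding \<theta>_def by (auto intro!: derivative_eq_intros)
      then show ?thesis by (simp add: vH[OF D])
    qed
    show "(I has_vector_derivative (\<chi> i. - partial_on ?D (Inl i) H (\<theta> t, I t))) (at t within J)"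
      using kH[OF D] phase unfolding I_def by (auto intro!: derivative_eq_intros)
  qed
  have "J' = J" if sol': "hamiltonian_solution ?D H J' \<theta>' I'" and "J \<subseteq> J'"
      and ext: "\<forall>t\<in>J. \<theta>' t = \<theta> t \<and> I' t = I t" for J' \<theta>' I'
  proof
    have conv: "convex J'"
      using sol' is_interval_convex by (auto simp: hamiltonian_solution_def)
    have D: "(\<theta>' t, I' t) \<in> ?D" if "t \<in> J'" for t
      using sol' that by (simp add: hamiltonian_solution_def)
    have 0: "0 \<in> J" "0 \<in> J'" using J \<open>T > 0\<close> \<open>J \<subseteq> J'\<close> by auto
    have d\<theta>: "((\<lambda>t. \<theta>' t - t *\<^sub>R v) has_vector_derivative 0) (at t within J')" if "t \<in> J'" for t
    proof -
      have "(\<theta>' has_vector_derivative v) (at t within J')"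
        unfolding vH[OF D[OF that], symmetric] using sol' that unfolding hamiltonian_solution_def by blast
      then show ?thesis by (auto intro!: derivative_eq_intros)
    qed
    obtain a where a: "\<And>t. t \<in> J' \<Longrightarrow> \<theta>' t - t *\<^sub>R v = a"
      using has_vector_derivative_zero_constant[OF conv d\<theta>] by blast
    have "a = \<theta> 0" using a[OF 0(2)] ext 0(1) by simp
    then have "\<theta>' t - t *\<^sub>R v = \<theta> 0" if "t \<in> J'" for t using a that by simp
    then have \<theta>': "\<theta>' t = \<theta> t" if "t \<in> J'" for t
      using that by (simp add: \<theta>_def diff_eq_eq)
    have dI: "((\<lambda>t. I' t - (2 * pi * A * t) *\<^sub>R k) has_vector_derivative 0) (at t within J')" if "t \<in> J'" for t
    proof -
      have ph: "k \<bullet> fst (\<theta>' t, I' t) = 1 / 4" using \<theta>'[OF that] phase by simp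
      have "(I' has_vector_derivative (2 * pi * A) *\<^sub>R k) (at t within J')"
        unfolding kH[OF D[OF that] ph, symmetric] using sol' that unfolding hamiltonian_solution_def by blast
      then show ?thesis by (auto intro!: derivative_eq_intros)
    qed
    obtain b where b: "\<And>t. t \<in> J' \<Longrightarrow> I' t - (2 * pi * A * t) *\<^sub>R k = b"
      using has_vector_derivative_zero_constant[OF conv dI] by blast
    have "b = I 0" using b[OF 0(2)] ext 0(1) by simp
    then have "I' t - (2 * pi * A * t) *\<^sub>R k = I 0" if "t \<in> J'" for t using b that by simp
    then have I': "I' t = I t" if "t \<in> J'" for t
      using that by (simp add: I_def)
    show "J' \<subseteq> J" using D I' by (auto simp: J_def phase_domain_def)
  qed (use \<open>J \<subseteq> J'\<close> in auto)
  then have "maximal_hamiltonian_solution ?D H J \<theta> I"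
    unfolding maximal_hamiltonian_solution_def using sol by blast
  moreover have "0 \<in> interior J" using J \<open>T > 0\<close> by simp
  ultimately show ?thesis by blast
qed

section \<open>The instability theorem\<close>

text \<open>Half of the exponential decay absorbs the factor \<open>Q\<close>: with \<open>y = Q powr (1 / \<alpha>)\<close>, this is
  \<open>x \<le> exp x\<close> at \<open>x = c * y / (2 * \<alpha>)\<close>, raised to the power \<open>\<alpha>\<close>.\<close>

lemma linear_times_exp_le:
  fixes Q :: real
  assumes "\<alpha> > 0" "c > 0" "Q > 0"
  shows "Q * exp (- c * Q powr (1 / \<alpha>)) \<le> (2 * \<alpha> / c) powr \<alpha> * exp (- (c / 2) * Q powr (1 / \<alpha>))"
proof -
  define y where "y = Q powr (1 / \<alpha>)"
  have y: "y > 0" "Q = y powr \<alpha>" using assms by (auto simp: y_def powr_powr)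
  have "c * y / (2 * \<alpha>) \<le> exp (c * y / (2 * \<alpha>))"
    using exp_ge_add_one_self[of "c * y / (2 * \<alpha>)"] by linarith
  then have "y \<le> (2 * \<alpha> / c) * exp (c * y / (2 * \<alpha>))"
    using assms by (simp add: field_simps)
  then have "y powr \<alpha> \<le> ((2 * \<alpha> / c) * exp (c * y / (2 * \<alpha>))) powr \<alpha>"
    using assms y by (intro powr_mono2) auto
  also have "\<dots> = (2 * \<alpha> / c) powr \<alpha> * exp (c / 2 * y)"
    using assms by (subst powr_mult) (simp_all add: exp_powr_real mult.commute)
  finally have "Q * exp (- c * y) \<le> ((2 * \<alpha> / c) powr \<alpha> * exp (c / 2 * y)) * exp (- c * y)"
    unfolding y(2) by (intro mult_right_mono) auto
  also have "\<dots> = (2 * \<alpha> / c) powr \<alpha> * exp (- (c / 2) * y)"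
    by (simp add: mult.assoc flip: exp_add)
  finally show ?thesis by (simp add: y_def)
qed

theorem theorem2p3:
  fixes \<omega> :: "real ^ 'n::finite" and R \<alpha> L Q\<^sub>\<omega> :: real
  assumes "CARD('n) \<ge> 2" and "R > 0" and "\<alpha> \<ge> 1" and "L > 0" and "\<omega> \<noteq> 0"
    and "admissible_Q \<omega> Q\<^sub>\<omega>"
  shows "\<exists>(\<epsilon> :: nat \<Rightarrow> real) (f :: nat \<Rightarrow> 'n phase \<Rightarrow> real)
           (a1 :: real) (a2 :: real) (a3 :: real) (a4 :: real)
           (a5 :: real) (a6 :: real) (a7 :: real) (a8 :: real) (j0 :: nat).
     a1 > 0 \<and> a2 > 0 \<and> a3 > 0 \<and> a4 > 0 \<and> a5 > 0 \<and> a6 > 0 \<and> a7 > 0 \<and> a8 > 0 \<and> j0 > 0 \<and>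
     (\<forall>j. \<epsilon> j > 0 \<and> f j \<in> gevrey_class \<alpha> L (phase_domain R) \<and>
          a1 * \<epsilon> j \<le> gevrey_norm \<alpha> L (phase_domain R) (f j) \<and>
          gevrey_norm \<alpha> L (phase_domain R) (f j) \<le> a2 * \<epsilon> j) \<and>
     \<epsilon> \<longlonglongrightarrow> 0 \<and>
     (\<forall>j\<ge>j0.
        a5 * inverse (\<epsilon> j) \<ge> Delta \<omega> Q\<^sub>\<omega> \<and> a8 * inverse (\<epsilon> j) \<ge> Delta \<omega> Q\<^sub>\<omega> \<and>
        (\<exists>J \<theta> I.
           0 \<in> interior J \<and>
           maximal_hamiltonian_solution (phase_domain R)
             (\<lambda>z. \<omega> \<bullet> snd z + f j z) J \<theta> I \<and>
           (\<forall>t\<in>J.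
              a3 * \<bar>t\<bar> * \<epsilon> j * exp (- a4 * Delta_star \<omega> Q\<^sub>\<omega> (a5 * inverse (\<epsilon> j)) powr (1 / \<alpha>))
                \<le> infnorm (orth_proj (rat_hull \<omega>) (I t - I 0)) \<and>
              infnorm (orth_proj (rat_hull \<omega>) (I t - I 0))
                \<le> a6 * \<bar>t\<bar> * \<epsilon> j * exp (- a7 * Delta_star \<omega> Q\<^sub>\<omega> (a8 * inverse (\<epsilon> j)) powr (1 / \<alpha>)))))"
proof -
  note adm = \<open>admissible_Q \<omega> Q\<^sub>\<omega>\<close>
  have "\<alpha> > 0" using \<open>\<alpha> \<ge> 1\<close> by simp
  have "Q\<^sub>\<omega> > 0" using adm by (simp add: admissible_Q_def)
  have "\<exists>k kF. drift_pair \<omega> k kF \<and> infnorm k > Q\<^sub>\<omega> + real j" for j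
    using drift_frequency[OF assms(1) adm, of "Q\<^sub>\<omega> + real j"]
    by (metis le_add_same_cancel1 of_nat_0_le_iff)
  then obtain k kF where pair: "\<And>j. drift_pair \<omega> (k j) (kF j)"
    and large_k: "\<And>j. infnorm (k j) > Q\<^sub>\<omega> + real j" by metis
  define Q where "Q j = infnorm (k j)" for j
  have Q: "Q j > Q\<^sub>\<omega>" "Q j > real j" "Q j > 0" for j
    using large_k[of j] \<open>Q\<^sub>\<omega> > 0\<close> by (auto simp: Q_def)
  have knz: "k j \<noteq> 0" for j using Q(3)[of j] by (auto simp: Q_def infnorm_0)
  define \<epsilon> where "\<epsilon> j = \<bar>k j \<bullet> \<omega>\<bar> / Q j" for j
  have \<epsilon>pos: "\<epsilon> j > 0" for j using pair[of j] Q(3)[of j] by (simp add: \<epsilon>_def drift_pair_def)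
  have \<epsilon>Delta: "inverse (\<epsilon> j) = Delta \<omega> (Q j)" for j
    using pair[of j] by (simp add: \<epsilon>_def Delta_def drift_pair_def Q_def divide_inverse)
  have star: "Delta_star \<omega> Q\<^sub>\<omega> (inverse (\<epsilon> j)) = Q j" for j
    unfolding \<epsilon>Delta by (rule Delta_star_Delta[OF adm]) (use Q(1)[of j] in simp)
  have large: "Delta \<omega> Q\<^sub>\<omega> \<le> inverse (\<epsilon> j)" for j
    unfolding \<epsilon>Delta using Delta_strict_mono[OF adm order_refl Q(1)[of j]] by simp
  have "\<forall>j. \<exists>i. \<bar>k j $ i\<bar> = Q j" unfolding Q_def using infnorm_attained by metis
  then obtain i where i: "\<And>j. \<bar>k j $ i j\<bar> = Q j" by metis
  \<comment> \<open>Shifting the frequency by \<open>s\<close> in the coordinate where \<open>k\<close> is largest makes \<open>k\<close> resonant at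
    the least cost among shifts of a single coordinate.\<close>
  define s where "s j = - (k j \<bullet> \<omega>) / (k j $ i j)" for j
  have s: "\<bar>s j\<bar> = \<epsilon> j" for j by (simp add: s_def \<epsilon>_def i abs_divide)
  have snz: "s j \<noteq> 0" for j using s[of j] \<epsilon>pos[of j] by auto
  define c where "c = \<alpha> * real CARD('n + 'n) * L * (2 * pi) powr (1 / \<alpha>)"
  have "c > 0" using \<open>\<alpha> > 0\<close> \<open>L > 0\<close> by (simp add: c_def)
  define A where "A j = \<epsilon> j * exp (- c * Q j powr (1 / \<alpha>))" for j
  have Apos: "A j > 0" for j using \<epsilon>pos by (simp add: A_def)
  define f where "f j = wave (k j) (axis (i j) (s j)) 0 (A j) 0" for j
  have kint: "k j \<in> int_vectors" for j using pair by (simp add: drift_pair_def)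
  have gev: "f j \<in> gevrey_class \<alpha> L (phase_domain R)"
      "R * \<epsilon> j \<le> gevrey_norm \<alpha> L (phase_domain R) (f j)"
      "gevrey_norm \<alpha> L (phase_domain R) (f j) \<le> (1 + R + L powr \<alpha>) * \<epsilon> j" for j
    using gevrey_wave[OF \<open>R > 0\<close> \<open>\<alpha> > 0\<close> \<open>L > 0\<close> kint[of j] knz[of j] snz[of j], where i = "i j"]
    by (simp_all add: f_def A_def c_def s Q_def)
  have lim: "\<epsilon> \<longlonglongrightarrow> 0"
  proof (rule tendsto_sandwich[of "\<lambda>_. 0"])
    have Psi0: "Psi \<omega> Q\<^sub>\<omega> > 0" using adm by (intro Psi_pos) (auto simp: admissible_Q_def)
    have "\<epsilon> j \<le> inverse (Psi \<omega> Q\<^sub>\<omega>) * inverse (real j)" if "j > 0" for j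
    proof -
      have "Psi \<omega> Q\<^sub>\<omega> * real j \<le> Psi \<omega> (Q j) * Q j"
        using Q[of j] adm Psi0 by (intro mult_mono Psi_mono less_imp_le[OF Psi_pos])
          (auto simp: admissible_Q_def)
      also have "\<dots> = inverse (\<epsilon> j)" by (simp add: \<epsilon>Delta Delta_def)
      finally have "inverse (inverse (\<epsilon> j)) \<le> inverse (Psi \<omega> Q\<^sub>\<omega> * real j)"
        using Psi0 that by (intro le_imp_inverse_le) auto
      then show ?thesis by simp
    qed
    then show "\<forall>\<^sub>F j in sequentially. \<epsilon> j \<le> inverse (Psi \<omega> Q\<^sub>\<omega>) * inverse (real j)"
      by (intro eventually_sequentiallyI[of 1]) auto
    show "(\<lambda>j. inverse (Psi \<omega> Q\<^sub>\<omega>) * inverse (real j)) \<longlonglongrightarrow> 0"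
      by (rule tendsto_mult_right_zero[OF lim_inverse_n])
  qed (auto intro!: always_eventually less_imp_le \<epsilon>pos)
  have drift: "\<exists>J \<theta> I. 0 \<in> interior J \<and>
      maximal_hamiltonian_solution (phase_domain R) (\<lambda>z. \<omega> \<bullet> snd z + f j z) J \<theta> I \<and>
      (\<forall>t\<in>J. 2 * pi * \<bar>t\<bar> * \<epsilon> j * exp (- c * Q j powr (1 / \<alpha>))
          \<le> infnorm (orth_proj (rat_hull \<omega>) (I t - I 0)) \<and>
        infnorm (orth_proj (rat_hull \<omega>) (I t - I 0))
          \<le> 2 * pi * (2 * \<alpha> / c) powr \<alpha> * \<bar>t\<bar> * \<epsilon> j * exp (- (c / 2) * Q j powr (1 / \<alpha>)))" for j
  proof -
    let ?v = "\<omega> + axis (i j) (s j)"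
    define I where "I t = (2 * pi * A j * t) *\<^sub>R k j" for t
    have "k j $ i j \<noteq> 0" using i[of j] Q(3)[of j] by auto
    then have "k j \<bullet> ?v = 0" by (simp add: inner_add_right inner_axis s_def)
    moreover have "(\<lambda>z. \<omega> \<bullet> snd z + f j z) = wave (k j) ?v 0 (A j) 0"
      by (auto simp: f_def wave_def inner_add_left)
    ultimately obtain J \<theta> where sol: "0 \<in> interior J"
        "maximal_hamiltonian_solution (phase_domain R) (\<lambda>z. \<omega> \<bullet> snd z + f j z) J \<theta> I"
      using resonant_wave_solution[OF \<open>R > 0\<close> Apos knz, of j ?v j] unfolding I_def by metis
    have proj: "infnorm (orth_proj (rat_hull \<omega>) (I t - I 0)) = 2 * pi * \<bar>t\<bar> * (A j * infnorm (kF j))" for t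
    proof -
      have "orth_proj (rat_hull \<omega>) (I t) = (2 * pi * A j * t) *\<^sub>R kF j"
        using pair[of j] unfolding I_def
        by (intro orth_proj_eqI subspace_rat_hull subspace_scale)
           (auto simp: drift_pair_def orthogonal_clauses simp flip: scaleR_diff_right)
      then show ?thesis using Apos[of j] by (simp add: I_def infnorm_mul abs_mult)
    qed
    have low: "A j * 1 \<le> A j * infnorm (kF j)"
      using pair[of j] Apos[of j] by (intro mult_left_mono int_vectors_infnorm_ge_1) (auto simp: drift_pair_def)
    have up: "A j * infnorm (kF j) \<le> \<epsilon> j * ((2 * \<alpha> / c) powr \<alpha> * exp (- (c / 2) * Q j powr (1 / \<alpha>)))"
    proof -
      have "A j * infnorm (kF j) \<le> A j * Q j"
        using pair[of j] Apos[of j] by (simp add: drift_pair_def Q_def)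
      also have "\<dots> = \<epsilon> j * (Q j * exp (- c * Q j powr (1 / \<alpha>)))" by (simp add: A_def)
      also have "\<dots> \<le> \<epsilon> j * ((2 * \<alpha> / c) powr \<alpha> * exp (- (c / 2) * Q j powr (1 / \<alpha>)))"
        using linear_times_exp_le[OF \<open>\<alpha> > 0\<close> \<open>c > 0\<close> Q(3)] \<epsilon>pos[of j] by (intro mult_left_mono) auto
      finally show ?thesis .
    qed
    have "2 * pi * \<bar>t\<bar> * (A j * 1) \<le> infnorm (orth_proj (rat_hull \<omega>) (I t - I 0))"
      "infnorm (orth_proj (rat_hull \<omega>) (I t - I 0))
          \<le> 2 * pi * \<bar>t\<bar> * (\<epsilon> j * ((2 * \<alpha> / c) powr \<alpha> * exp (- (c / 2) * Q j powr (1 / \<alpha>))))" for t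
      unfolding proj by (rule mult_left_mono[OF low] mult_left_mono[OF up]; simp)+
    then show ?thesis using sol
      by (intro exI[of _ J] exI[of _ \<theta>] exI[of _ I]) (auto simp: A_def mult_ac)
  qed
  have pos: "1 + R + L powr \<alpha> > 0" "2 * pi > 0" "2 * pi * (2 * \<alpha> / c) powr \<alpha> > 0" "c / 2 > 0"
      "(1::real) > 0" "(1::nat) > 0"
    using \<open>R > 0\<close> \<open>\<alpha> > 0\<close> \<open>c > 0\<close> by (simp_all add: add_pos_nonneg)
  show ?thesis
    by (rule exI[of _ \<epsilon>], rule exI[of _ f], rule exI[of _ R], rule exI[of _ "1 + R + L powr \<alpha>"],
        rule exI[of _ "2 * pi"], rule exI[of _ c], rule exI[of _ 1],
        rule exI[of _ "2 * pi * (2 * \<alpha> / c) powr \<alpha>"], rule exI[of _ "c / 2"],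
        rule exI[of _ 1], rule exI[of _ 1], unfold mult_1 star)
       (intro conjI allI impI pos \<open>R > 0\<close> \<open>c > 0\<close> gev \<epsilon>pos lim large drift)
qed

end
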